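(* Assume the standing assumption, the set-regularity assumption and the parameterized data assumptions stated in the context. For $(\zeta,\eta)\in H\times E$ let $(x_{\zeta,\eta},u_{\zeta,\eta})$ denote the unique mild solution pair with data $(\zeta,\eta)$. If $(\zeta_n,\eta_n)\to(\zeta,\eta)$ in $H\times E$, then the corresponding solution pairs $(x_n,u_n):=(x_{\zeta_n,\eta_n},u_{\zeta_n,\eta_n})$ and $(x,u):=(x_{\zeta,\eta},u_{\zeta,\eta})$ satisfy $$(x_n,u_n)\longrightarrow(x,u)\quad\text{in } C([0,T];H)\times C([0,T];H).$$ Thus the solution map $\mathcal S(\zeta,\eta):=(x_{\zeta,\eta},u_{\zeta,\eta})$ is continuous from $H\times E$ to $C([0,T];H)\times C([0,T];H)$.
   Context: Let $H$ be a separable real Hilbert space with inner product $\langle\cdot,\cdot\rangle$ and norm $\|\cdot\|$, $\mathbb B_R(0)$ its closed ball of radius $R$ centered at $0$, $T>0$, and $(E,d_E)$ a metric space. $H\times E$ carries the metric $d((\zeta_1,\eta_1),(\zeta_2,\eta_2)):=\|\zeta_1-\zeta_2\|+d_E(\eta_1,\eta_2)$, and $C([0,T];H)$ the maximum norm. For nonempty closed convex $C\subset H$, $\mathrm{proj}_C$ is the metric projection, and $N_C(y)=\{\xi\in H:\langle\xi,v-y\rangle\le0\ \forall v\in C\}$ if $y\in C$, $N_C(y)=\emptyset$ otherwise. A mapping $G:[0,T]\times X\to H$ ($X$ a separable metric space) is Carathéodory if $t\mapsto G(t,z)$ is strongly measurable for every $z\in X$, and $z\mapsto G(t,z)$ is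 continuous for a.e. $t\in[0,T]$. An operator $F:H\to H$ is strongly pseudomonotone on $C\subset H$ with modulus $m>0$ if for all $y,z\in C$: $\langle F(y),z-y\rangle\ge0$ implies $\langle F(z),z-y\rangle\ge m\|z-y\|^2$. A modulus is a function $\mathbb R_+\to\mathbb R_+$ tending to zero at zero. Standing assumption: $A$ generates a strongly continuous semigroup $\{e^{At}\}_{t\ge0}$ on $H$; $P:H\to H$ is linear, bounded, self-adjoint and coercive (hence invertible with bounded inverse); $K:[0,T]\rightrightarrows H$ has nonempty, closed, convex values; $f,h:[0,T]\times H\times H\times E\to H$, and for every $\eta\in E$, $f(\cdot,\cdot,\cdot,\eta)$ and $h(\cdot,\cdot,\cdot,\eta)$ are Carathéodory and $f(\cdot,0,0,\eta)\in L^1(0,T;H)$. Set-regularity assumption: for every $R\ge0$ there is a continuous $\omega_{K,R}:\mathbb R_+\to\mathbb R_+$ with $\lim_{r\to0^+}\omega_{K,R}(r)=0$ and $\|\mathrm{proj}_{K(t_1)}(z)-\mathrm{proj}_{K(t_2)}(z)\|\le\omega_{K,R}(|t_1-t_2|)$ for all $t_1,t_2\in[0,T]$, $z\in\mathbb B_R(0)$. Parameterized data assumptions: (i) for every $\eta\in E$, $(t,x,u)\mapsto f(t,x,u,\eta)$ and $(t,x,u)\mapsto h(t,x,u,\eta)$ are Carathéodory. (ii) For every bounded $D\subset E$ there are $\alpha_f(D),\beta_f(D),\alpha_h(D)\ge0$ such that for all $t\in[0,T]$, $\eta\in D$, $x_1,x_2,u_1,u_2,u\in H$: $\|f(t,x_1,u_1,\eta)-f(t,x_2,u_2,\eta)\|\le\alpha_f(D)\|x_1-x_2\|+\beta_f(D)\|u_1-u_2\|$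 and $\|h(t,x_1,u,\eta)-h(t,x_2,u,\eta)\|\le\alpha_h(D)\|x_1-x_2\|$. (iii) For every bounded $D\subset E$ and $R\ge0$ there are moduli $\gamma_{f,D,R},\gamma_{h,D,R}$ such that for $t\in[0,T]$, $\eta_1,\eta_2\in D$, $x,u\in\mathbb B_R(0)$: $\|f(t,x,u,\eta_1)-f(t,x,u,\eta_2)\|\le\gamma_{f,D,R}(d_E(\eta_1,\eta_2))$ and $\|h(t,x,u,\eta_1)-h(t,x,u,\eta_2)\|\le\gamma_{h,D,R}(d_E(\eta_1,\eta_2))$. (iv) For every bounded $D\subset E$ and $R\ge0$ there is a modulus $\omega_{h,D,R}$ with $\|h(t_1,x,u,\eta)-h(t_2,x,u,\eta)\|\le\omega_{h,D,R}(|t_1-t_2|)$ for $t_1,t_2\in[0,T]$, $\eta\in D$, $x,u\in\mathbb B_R(0)$. (v) For every bounded $D\subset E$ there are $\gamma(D),L_F(D)>0$ such that for all $\eta\in D$, $t\in[0,T]$, $x\in H$, the operator $F^\eta_{t,x}(y):=P^{-1}y-h(t,x,P^{-1}y,\eta)$ is strongly pseudomonotone on $K(t)$ with modulus $\gamma(D)$ and Lipschitz continuous on $H$ with modulus $L_F(D)$. (vi) For every bounded $D\subset E$ there is $C_{h,0}(D)\ge0$ with $\|h(t,0,0,\eta)\|\le C_{h,0}(D)$ for $\eta\in D$, $t\in[0,T]$. (vii) For every bounded $D\subset E$ there is $C_{f,0}(D)\ge0$ with $\|f(t,0,0,\eta)\|\le C_{f,0}(D)$ for $\eta\in D$, $t\in[0,T]$.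 A mild solution pair with data $(\zeta,\eta)\in H\times E$ is a pair $(x,u)\in C([0,T];H)\times C([0,T];H)$ with $x(t)=e^{At}\zeta+\int_0^te^{A(t-s)}f(s,x(s),u(s),\eta)\,ds$ for all $t\in[0,T]$ and $u(t)\in h(t,x(t),u(t),\eta)-N_{K(t)}(Pu(t))$ for a.e. $t\in(0,T)$. Under the assumptions above such a pair exists and is unique for every $(\zeta,\eta)$. *)

theory Defs
  imports "HOL-Analysis.Analysis"
begin

text \<open>
  A separable real Hilbert space is a type of sort
  \<open>{real_inner, banach, second_countable_topology}\<close> (for metric spaces, second countable means
  separable).  Functions of time are total on \<open>real\<close>, but only their values on \<open>{0..T}\<close> are ever used.
\<close>

section \<open>Convex analysis\<close>

text \<open>The library's \<open>closest_point\<close> has sort \<open>heine_borel\<close>, i.e. it is finite-dimensional only.\<close>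

definition metric_proj :: "'h::real_inner set \<Rightarrow> 'h \<Rightarrow> 'h" where
  "metric_proj C z = (THE y. y \<in> C \<and> (\<forall>v\<in>C. dist z y \<le> dist z v))"

definition normal_cone :: "'h::real_inner set \<Rightarrow> 'h \<Rightarrow> 'h set" where
  "normal_cone C y = (if y \<in> C then {\<xi>. \<forall>v\<in>C. inner \<xi> (v - y) \<le> 0} else {})"

definition strongly_pseudomonotone_on :: "real \<Rightarrow> 'h::real_inner set \<Rightarrow> ('h \<Rightarrow> 'h) \<Rightarrow> bool" where
  "strongly_pseudomonotone_on m C F \<longleftrightarrow>
     m > 0 \<and>
     (\<forall>y\<in>C. \<forall>z\<in>C. inner (F y) (z - y) \<ge> 0 \<longrightarrow> inner (F z) (z - y) \<ge> m * (norm (z - y))\<^sup>2)"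

section \<open>Operators and semigroups\<close>

definition self_adjoint :: "('h::real_inner \<Rightarrow> 'h) \<Rightarrow> bool" where
  "self_adjoint P \<longleftrightarrow> (\<forall>x y. inner (P x) y = inner x (P y))"

definition coercive :: "('h::real_inner \<Rightarrow> 'h) \<Rightarrow> bool" where
  "coercive P \<longleftrightarrow> (\<exists>c>0. \<forall>x. inner (P x) x \<ge> c * (norm x)\<^sup>2)"

definition C0_semigroup :: "(real \<Rightarrow> 'h::real_normed_vector \<Rightarrow> 'h) \<Rightarrow> bool" where
  "C0_semigroup S \<longleftrightarrow>
     (\<forall>t\<ge>0. bounded_linear (S t)) \<and>
     (\<forall>x. S 0 x = x) \<and>
     (\<forall>s\<ge>0. \<forall>t\<ge>0. \<forall>x. S (s + t) x = S s (S t x)) \<and>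
     (\<forall>x. ((\<lambda>t. S t x) \<longlongrightarrow> x) (at_right 0))"

text \<open>
  The generator of a semigroup is in general an unbounded operator defined only on a subspace;
  it is represented by its graph.
\<close>

definition generates ::
  "('h::real_normed_vector \<times> 'h) set \<Rightarrow> (real \<Rightarrow> 'h \<Rightarrow> 'h) \<Rightarrow> bool" where
  "generates A S \<longleftrightarrow>
     C0_semigroup S \<and>
     A = {(x, y). ((\<lambda>t. (S t x - x) /\<^sub>R t) \<longlongrightarrow> y) (at_right 0)}"

section \<open>Moduli and Caratheodory maps\<close>

definition modulus :: "(real \<Rightarrow> real) \<Rightarrow> bool" where
  "modulus g \<longleftrightarrow> (\<forall>r\<ge>0. g r \<ge> 0) \<and> (g \<longlongrightarrow> 0) (at_right 0)"

text \<open>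
  Strong measurability is Borel measurability with respect to the completed (Lebesgue)
  sigma-algebra: the two agree because the target space is separable.
\<close>

definition caratheodory ::
  "real \<Rightarrow> (real \<Rightarrow> 'x::{metric_space, second_countable_topology} \<Rightarrow>
     'h::{real_inner, banach, second_countable_topology}) \<Rightarrow> bool" where
  "caratheodory T G \<longleftrightarrow>
     (\<forall>z. (\<lambda>t. G t z) \<in> borel_measurable (lebesgue_on {0..T})) \<and>
     (AE t in lebesgue_on {0..T}. continuous_on UNIV (G t))"

section \<open>Assumptions on the data\<close>

definition standing_assumption ::
  "real \<Rightarrow> ('h \<times> 'h) set \<Rightarrow> (real \<Rightarrow> 'h \<Rightarrow> 'h) \<Rightarrow> ('h \<Rightarrow> 'h) \<Rightarrow> (real \<Rightarrow> 'h set) \<Rightarrow>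
   (real \<Rightarrow> 'h \<Rightarrow> 'h \<Rightarrow> 'e::metric_space \<Rightarrow> 'h) \<Rightarrow>
   (real \<Rightarrow> 'h \<Rightarrow> 'h \<Rightarrow> 'e \<Rightarrow> 'h::{real_inner, banach, second_countable_topology}) \<Rightarrow> bool" where
  "standing_assumption T A expA P K f h \<longleftrightarrow>
     generates A expA \<and>
     bounded_linear P \<and> self_adjoint P \<and> coercive P \<and>
     (\<forall>t\<in>{0..T}. K t \<noteq> {} \<and> closed (K t) \<and> convex (K t)) \<and>
     (\<forall>\<eta>. caratheodory T (\<lambda>t (x, u). f t x u \<eta>) \<and>
          caratheodory T (\<lambda>t (x, u). h t x u \<eta>) \<and>
          set_integrable lebesgue {0..T} (\<lambda>t. f t 0 0 \<eta>))"

definition set_regularity :: "real \<Rightarrow> (real \<Rightarrow> 'h::real_inner set) \<Rightarrow> bool" where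
  "set_regularity T K \<longleftrightarrow>
     (\<forall>R\<ge>0. \<exists>\<omega>. modulus \<omega> \<and> continuous_on {0..} \<omega> \<and>
        (\<forall>t1\<in>{0..T}. \<forall>t2\<in>{0..T}. \<forall>z\<in>cball 0 R.
           norm (metric_proj (K t1) z - metric_proj (K t2) z) \<le> \<omega> \<bar>t1 - t2\<bar>))"

definition F_op ::
  "('h \<Rightarrow> 'h) \<Rightarrow> (real \<Rightarrow> 'h \<Rightarrow> 'h \<Rightarrow> 'e \<Rightarrow> 'h::real_inner) \<Rightarrow> 'e \<Rightarrow> real \<Rightarrow> 'h \<Rightarrow> 'h \<Rightarrow> 'h" where
  "F_op P h \<eta> t x = (\<lambda>y. inv P y - h t x (inv P y) \<eta>)"

definition parameterized_data ::
  "real \<Rightarrow> ('h \<Rightarrow> 'h) \<Rightarrow> (real \<Rightarrow> 'h set) \<Rightarrow>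
   (real \<Rightarrow> 'h \<Rightarrow> 'h \<Rightarrow> 'e::metric_space \<Rightarrow> 'h) \<Rightarrow>
   (real \<Rightarrow> 'h \<Rightarrow> 'h \<Rightarrow> 'e \<Rightarrow> 'h::{real_inner, banach, second_countable_topology}) \<Rightarrow> bool" where
  "parameterized_data T P K f h \<longleftrightarrow>
     (\<forall>\<eta>. caratheodory T (\<lambda>t (x, u). f t x u \<eta>) \<and>
          caratheodory T (\<lambda>t (x, u). h t x u \<eta>)) \<and>
     (\<forall>D. bounded D \<longrightarrow> (\<exists>\<alpha>f \<beta>f \<alpha>h. \<alpha>f \<ge> 0 \<and> \<beta>f \<ge> 0 \<and> \<alpha>h \<ge> 0 \<and>
        (\<forall>t\<in>{0..T}. \<forall>\<eta>\<in>D. \<forall>x1 x2 u1 u2 u.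
           norm (f t x1 u1 \<eta> - f t x2 u2 \<eta>) \<le> \<alpha>f * norm (x1 - x2) + \<beta>f * norm (u1 - u2) \<and>
           norm (h t x1 u \<eta> - h t x2 u \<eta>) \<le> \<alpha>h * norm (x1 - x2)))) \<and>
     (\<forall>D. bounded D \<longrightarrow> (\<forall>R\<ge>0. \<exists>\<gamma>f \<gamma>h. modulus \<gamma>f \<and> modulus \<gamma>h \<and>
        (\<forall>t\<in>{0..T}. \<forall>\<eta>1\<in>D. \<forall>\<eta>2\<in>D. \<forall>x\<in>cball 0 R. \<forall>u\<in>cball 0 R.
           norm (f t x u \<eta>1 - f t x u \<eta>2) \<le> \<gamma>f (dist \<eta>1 \<eta>2) \<and>
           norm (h t x u \<eta>1 - h t x u \<eta>2) \<le> \<gamma>h (dist \<eta>1 \<eta>2)))) \<and>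
     (\<forall>D. bounded D \<longrightarrow> (\<forall>R\<ge>0. \<exists>\<omega>. modulus \<omega> \<and>
        (\<forall>t1\<in>{0..T}. \<forall>t2\<in>{0..T}. \<forall>\<eta>\<in>D. \<forall>x\<in>cball 0 R. \<forall>u\<in>cball 0 R.
           norm (h t1 x u \<eta> - h t2 x u \<eta>) \<le> \<omega> \<bar>t1 - t2\<bar>))) \<and>
     (\<forall>D. bounded D \<longrightarrow> (\<exists>\<gamma> L. \<gamma> > 0 \<and> L > 0 \<and>
        (\<forall>\<eta>\<in>D. \<forall>t\<in>{0..T}. \<forall>x.
           strongly_pseudomonotone_on \<gamma> (K t) (F_op P h \<eta> t x) \<and>
           L-lipschitz_on UNIV (F_op P h \<eta> t x)))) \<and>
     (\<forall>D. bounded D \<longrightarrow> (\<exists>C\<ge>0. \<forall>\<eta>\<in>D. \<forall>t\<in>{0..T}. norm (h t 0 0 \<eta>) \<le> C)) \<and>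
     (\<forall>D. bounded D \<longrightarrow> (\<exists>C\<ge>0. \<forall>\<eta>\<in>D. \<forall>t\<in>{0..T}. norm (f t 0 0 \<eta>) \<le> C))"

section \<open>The metric spaces\<close>

definition data_metric :: "('h::real_normed_vector \<times> 'e::metric_space) metric" where
  "data_metric = metric (UNIV, \<lambda>(\<zeta>1, \<eta>1) (\<zeta>2, \<eta>2). norm (\<zeta>1 - \<zeta>2) + dist \<eta>1 \<eta>2)"

lemma Metric_space_data:
  "Metric_space UNIV
     (\<lambda>(\<zeta>1 :: 'h::real_normed_vector, \<eta>1 :: 'e::metric_space) (\<zeta>2, \<eta>2).
        norm (\<zeta>1 - \<zeta>2) + dist \<eta>1 \<eta>2)"
proof
  fix p q r :: "'h \<times> 'e"
  let ?d = "\<lambda>(\<zeta>1 :: 'h, \<eta>1 :: 'e) (\<zeta>2, \<eta>2). norm (\<zeta>1 - \<zeta>2) + dist \<eta>1 \<eta>2"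
  show "0 \<le> ?d p q" by (simp add: case_prod_beta)
  show "?d p q = ?d q p" by (simp add: case_prod_beta dist_commute norm_minus_commute)
  show "?d p q = 0 \<longleftrightarrow> p = q"
    by (simp add: case_prod_beta add_nonneg_eq_0_iff prod_eq_iff)
  have "norm (fst p - fst r) \<le> norm (fst p - fst q) + norm (fst q - fst r)"
    by (metis dist_norm dist_triangle)
  moreover have "dist (snd p) (snd r) \<le> dist (snd p) (snd q) + dist (snd q) (snd r)"
    by (rule dist_triangle)
  ultimately show "?d p r \<le> ?d p q + ?d q r" by (simp add: case_prod_beta)
qed

lemma mspace_data_metric [simp]: "mspace data_metric = UNIV"
  by (simp add: data_metric_def Metric_space.mspace_metric[OF Metric_space_data])

lemma mdist_data_metric [simp]:
  "mdist data_metric (\<zeta>1, \<eta>1) (\<zeta>2, \<eta>2) = norm (\<zeta>1 - \<zeta>2) + dist \<eta>1 \<eta>2"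
  by (simp add: data_metric_def Metric_space.mdist_metric[OF Metric_space_data])

text \<open>
  \<open>C([0,T];H)\<close> with the maximum norm.  Members are extensional, i.e. \<open>undefined\<close> off \<open>{0..T}\<close>,
  so that equality of members is equality on \<open>{0..T}\<close>.
\<close>

definition C_metric :: "real \<Rightarrow> (real \<Rightarrow> 'h::real_normed_vector) metric" where
  "C_metric T = cfunspace (top_of_set {0..T}) euclidean_metric"

lemma mspace_C_metric:
  "mspace (C_metric T) = {x. continuous_on {0..T} x \<and> x \<in> extensional {0..T}}"
proof -
  have "Metric_space.mbounded UNIV dist (x ` {0..T})"
    if "continuous_on {0..T} x" for x :: "real \<Rightarrow> 'a"
    using compact_imp_bounded[OF compact_continuous_image[OF that compact_Icc]] by simp
  then show ?thesis
    by (auto simp: C_metric_def)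
qed

lemma mdist_C_metric:
  assumes "x \<in> mspace (C_metric T)" "y \<in> mspace (C_metric T)" "T \<ge> 0"
  shows "mdist (C_metric T) x y = (SUP t\<in>{0..T}. norm (x t - y t))"
  using assms
  by (auto simp: C_metric_def mdist_cfunspace_eq_mdist_funspace dist_norm
        Metric_space.fdist_def[OF Met_TC.Metric_space_axioms]
        Metric_space.fspace_def[OF Met_TC.Metric_space_axioms])

section \<open>Mild solutions\<close>

text \<open>
  Integrability is part of the definition because the library integral of a non-integrable
  function is 0.
\<close>

definition mild_solution_pair ::
  "real \<Rightarrow> (real \<Rightarrow> 'h \<Rightarrow> 'h) \<Rightarrow> ('h \<Rightarrow> 'h) \<Rightarrow> (real \<Rightarrow> 'h set) \<Rightarrow>
   (real \<Rightarrow> 'h \<Rightarrow> 'h \<Rightarrow> 'e \<Rightarrow> 'h) \<Rightarrow>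
   (real \<Rightarrow> 'h \<Rightarrow> 'h \<Rightarrow> 'e \<Rightarrow> 'h::{real_inner, banach, second_countable_topology}) \<Rightarrow>
   'h \<times> 'e \<Rightarrow> (real \<Rightarrow> 'h) \<times> (real \<Rightarrow> 'h) \<Rightarrow> bool" where
  "mild_solution_pair T expA P K f h = (\<lambda>(\<zeta>, \<eta>) (x, u).
     x \<in> mspace (C_metric T) \<and> u \<in> mspace (C_metric T) \<and>
     (\<forall>t\<in>{0..T}.
        set_integrable lebesgue {0..t} (\<lambda>s. expA (t - s) (f s (x s) (u s) \<eta>)) \<and>
        x t = expA t \<zeta> + (LINT s:{0..t}|lebesgue. expA (t - s) (f s (x s) (u s) \<eta>))) \<and>
     (AE t in lebesgue_on {0<..<T}.
        u t \<in> (\<lambda>\<xi>. h t (x t) (u t) \<eta> - \<xi>) ` normal_cone (K t) (P (u t))))"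

definition solution_map ::
  "real \<Rightarrow> (real \<Rightarrow> 'h \<Rightarrow> 'h) \<Rightarrow> ('h \<Rightarrow> 'h) \<Rightarrow> (real \<Rightarrow> 'h set) \<Rightarrow>
   (real \<Rightarrow> 'h \<Rightarrow> 'h \<Rightarrow> 'e \<Rightarrow> 'h) \<Rightarrow>
   (real \<Rightarrow> 'h \<Rightarrow> 'h \<Rightarrow> 'e \<Rightarrow> 'h::{real_inner, banach, second_countable_topology}) \<Rightarrow>
   'h \<times> 'e \<Rightarrow> (real \<Rightarrow> 'h) \<times> (real \<Rightarrow> 'h)" where
  "solution_map T expA P K f h d = (THE p. mild_solution_pair T expA P K f h d p)"

end

theory Submission
  imports Defs
begin

text \<open>
  With \<open>y = P u\<close> the inclusion for \<open>u\<close> is a variational inequality on \<open>K t\<close> for a Lipschitz,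
  strongly pseudomonotone operator.  It has a unique solution, which depends Lipschitz
  continuously on the operator and continuously on the set; hence \<open>u t = U \<eta> t (x t)\<close> with \<open>U\<close>
  Lipschitz in the state, and the pair reduces to a semilinear evolution equation with Lipschitz
  right-hand side.  Existence follows from Banach's fixed point theorem in an exponentially
  weighted norm, and uniqueness and continuous dependence from a Gronwall estimate.

  Existence for the variational inequality: by strong pseudomonotonicity the sets
  \<open>{y. \<langle>F z, z - y\<rangle> \<ge> m \<parallel>z - y\<parallel>\<^sup>2}\<close> are balls that satisfy the covering condition of
  Knaster, Kuratowski and Mazurkiewicz, and a common point of them in the constraint set is a
  solution by Minty's argument.
\<close>

section \<open>Projections and intersections of convex sets in Hilbert space\<close>

text \<open>The operators are only pseudomonotone, so the projected step
  \<open>y \<mapsto> proj (y - \<rho> F y)\<close> is not known to contract, and existence comes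
  from an intersection property instead. Balls of infinite dimension are not compact: separability
  reduces the family of balls to a sequence, whose finite intersections with the constraint set
  decrease, and points of least norm take the place of compactness. The same existence result yields
  surjectivity of the coercive operator \<open>P\<close>. Since \<open>K t\<close> moves, a solution
  at one time need not be admissible at another; the comparison passes through projections of one
  frozen vector, whose norm is the radius used in the set regularity. In the stability estimates the
  perturbations of \<open>f\<close> and \<open>h\<close> are evaluated along the second solution
  only. With the limit solution in that place, the radius for the moduli is fixed before any
  perturbed solution is considered, so no a priori bound on the perturbed solutions is required. The
  inclusion holds almost everywhere, but continuity of \<open>U\<close> along continuous curves
  turns it into an identity at every time, so that \<open>u\<close> can be eliminated from the state
  equation.\<close>

lemma closest_point_exists_hilbert:
  fixes C :: "'h::{real_inner,banach} set"
  assumes "convex C" "closed C" "C \<noteq> {}"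
  obtains y where "y \<in> C" "\<forall>v\<in>C. dist z y \<le> dist z v"
proof -
  define s where "s = infdist z C"
  have s0: "s \<ge> 0" by (simp add: s_def infdist_nonneg)
  have low: "s \<le> dist z v" if "v \<in> C" for v
    using that by (simp add: s_def infdist_le)
  have "\<exists>a\<in>C. dist z a < s + 1 / Suc n" for n :: nat
  proof -
    have "(INF a\<in>C. dist z a) < s + 1 / Suc n"
      using assms(3) by (simp add: s_def infdist_notempty)
    then show ?thesis
      using assms(3) by (subst (asm) cINF_less_iff) auto
  qed
  then obtain a where aC: "\<And>n. a n \<in> C" and a: "\<And>n. dist z (a n) < s + 1 / Suc n"
    by metis
  \<comment> \<open>Parallelogram identity for two points of the minimizing sequence: their midpoint
    lies in \<open>C\<close>, hence at distance at least \<open>s\<close>, and what remains is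
    \<open>4 (s + e)^2 - 4 s^2\<close>.\<close>
  have par: "(dist (a m) (a n))\<^sup>2 \<le> 4 * (2 * s + 1) / Suc N" if "N \<le> m" "N \<le> n" for m n N
  proof -
    define e where "e = 1 / real (Suc N)"
    have e: "0 < e" "e \<le> 1" by (auto simp: e_def)
    have le: "dist z (a k) \<le> s + e" if "N \<le> k" for k
    proof -
      have "1 / real (Suc k) \<le> e" unfolding e_def using that by (intro divide_left_mono) auto
      with a[of k] show ?thesis by simp
    qed
    have sq: "(dist z (a k))\<^sup>2 \<le> (s + e)\<^sup>2" if "N \<le> k" for k
      using le[OF that] by (intro power_mono) auto
    have "(1/2) *\<^sub>R a m + (1/2) *\<^sub>R a n \<in> C"
      using assms(1) aC by (intro convexD) auto
    from low[OF this] have mid: "s\<^sup>2 \<le> (dist z ((1/2) *\<^sub>R a m + (1/2) *\<^sub>R a n))\<^sup>2"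
      using s0 by (intro power_mono)
    have "(dist (a m) (a n))\<^sup>2 = 2 * (dist z (a m))\<^sup>2 + 2 * (dist z (a n))\<^sup>2
        - 4 * (dist z ((1/2) *\<^sub>R a m + (1/2) *\<^sub>R a n))\<^sup>2"
      unfolding dist_norm power2_norm_eq_inner
      by (simp add: inner_simps inner_commute algebra_simps)
    also have "\<dots> \<le> 2 * (s + e)\<^sup>2 + 2 * (s + e)\<^sup>2 - 4 * s\<^sup>2"
      using sq[OF that(1)] sq[OF that(2)] mid by linarith
    also have "\<dots> = 4 * (2 * s + e) * e" by (simp add: power2_eq_square algebra_simps)
    also have "\<dots> \<le> 4 * (2 * s + 1) * e"
      using e s0 by (intro mult_right_mono) auto
    finally show ?thesis by (simp add: e_def)
  qed
  have "Cauchy a"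
  proof (rule metric_CauchyI)
    fix \<epsilon> :: real assume "\<epsilon> > 0"
    have "(\<lambda>N. 4 * (2 * s + 1) / Suc N) \<longlonglongrightarrow> 0"
      using lim_const_over_n by (rule LIMSEQ_Suc)
    then have "\<forall>\<^sub>F N in sequentially. 4 * (2 * s + 1) / Suc N < \<epsilon>\<^sup>2"
      using \<open>\<epsilon> > 0\<close> by (intro order_tendstoD) auto
    then obtain N where N: "4 * (2 * s + 1) / Suc N < \<epsilon>\<^sup>2"
      by (meson eventually_happens sequentially_bot)
    show "\<exists>M. \<forall>m\<ge>M. \<forall>n\<ge>M. dist (a m) (a n) < \<epsilon>"
    proof (intro exI[of _ N] allI impI)
      fix m n assume "N \<le> m" "N \<le> n"
      from par[OF this] N have "(dist (a m) (a n))\<^sup>2 < \<epsilon>\<^sup>2" by linarith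
      then show "dist (a m) (a n) < \<epsilon>" using \<open>\<epsilon> > 0\<close> by (simp add: power_less_imp_less_base)
    qed
  qed
  then obtain y where y: "a \<longlonglongrightarrow> y" by (meson Cauchy_convergent_iff convergent_def)
  have "y \<in> C" using assms(2) aC y by (meson closed_sequentially)
  have "dist z y \<le> s"
  proof (rule LIMSEQ_le[of "\<lambda>n. dist z (a n)" _ "\<lambda>n. s + 1 / Suc n"])
    show "(\<lambda>n. dist z (a n)) \<longlonglongrightarrow> dist z y" using y by (intro tendsto_intros)
    show "(\<lambda>n. s + 1 / Suc n) \<longlonglongrightarrow> s"
      using tendsto_add[OF tendsto_const[of s] LIMSEQ_Suc[OF lim_const_over_n[of 1]]] by simp
  qed (use a less_imp_le in blast)
  then show thesis using that \<open>y \<in> C\<close> low by fastforce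
qed

lemma metric_proj_closest:
  fixes C :: "'h::{real_inner,banach} set"
  assumes "convex C" "closed C" "C \<noteq> {}"
  shows metric_proj_in: "metric_proj C z \<in> C"
    and metric_proj_le: "\<forall>v\<in>C. dist z (metric_proj C z) \<le> dist z v"
proof -
  obtain y where "y \<in> C \<and> (\<forall>v\<in>C. dist z y \<le> dist z v)"
    using closest_point_exists_hilbert[OF assms] by metis
  then have "\<exists>!y. y \<in> C \<and> (\<forall>v\<in>C. dist z y \<le> dist z v)"
    using any_closest_point_unique[OF assms(1,2)] by blast
  from theI'[OF this] show "metric_proj C z \<in> C" "\<forall>v\<in>C. dist z (metric_proj C z) \<le> dist z v"
    by (simp_all add: metric_proj_def)
qed

lemma metric_proj_dot:
  fixes C :: "'h::{real_inner,banach} set"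
  assumes "convex C" "closed C" "v \<in> C"
  shows "inner (z - metric_proj C z) (v - metric_proj C z) \<le> 0"
  using any_closest_point_dot[OF assms(1,2) _ assms(3)] metric_proj_closest[OF assms(1,2)] assms(3)
  by blast

text \<open>The obtuse-angle inequalities at \<open>y\<close> and at the projection, each tested
  with the other point, add up to a nonpositive squared distance.\<close>

lemma metric_proj_eqI:
  fixes C :: "'h::{real_inner,banach} set"
  assumes "convex C" "closed C" "y \<in> C" "\<forall>v\<in>C. inner (z - y) (v - y) \<le> 0"
  shows "metric_proj C z = y"
proof -
  let ?p = "metric_proj C z"
  have "inner (z - y) (?p - y) \<le> 0" "inner (z - ?p) (y - ?p) \<le> 0"
    using assms metric_proj_in[OF assms(1,2)] metric_proj_dot[OF assms(1-3)] by blast+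
  then have "inner (?p - y) (?p - y) \<le> 0"
    by (simp add: inner_simps inner_commute algebra_simps)
  then show ?thesis
    by (metis inner_ge_zero inner_eq_zero_iff order_antisym right_minus_eq)
qed

text \<open>The points of least norm of the sets form a Cauchy sequence, since their norms increase
  and \<open>\<parallel>v - p\<parallel>\<^sup>2 \<le> \<parallel>v\<parallel>\<^sup>2 - \<parallel>p\<parallel>\<^sup>2\<close> for \<open>p\<close> of least norm in a convex set containing \<open>v\<close>;
  this replaces weak compactness.\<close>

lemma decseq_convex_Inter_nonempty:
  fixes E :: "nat \<Rightarrow> 'h::{real_inner,banach} set"
  assumes "\<And>n. convex (E n)" "\<And>n. closed (E n)" "\<And>n. E n \<noteq> {}"
    and "decseq E" "bounded (E 0)"
  shows "(\<Inter>n. E n) \<noteq> {}"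
proof -
  define p where "p n = metric_proj (E n) 0" for n
  have pE: "p n \<in> E n" for n
    unfolding p_def by (rule metric_proj_in[OF assms(1-3)])
  have sub: "p m \<in> E n" if "n \<le> m" for m n
    using pE[of m] decseqD[OF assms(4) that] by blast
  have key: "(norm (p m - p n))\<^sup>2 \<le> (norm (p m))\<^sup>2 - (norm (p n))\<^sup>2" if "n \<le> m" for m n
  proof -
    have "inner (0 - p n) (p m - p n) \<le> 0"
      unfolding p_def[of n] using sub[OF that] by (intro metric_proj_dot assms(1,2))
    then show ?thesis
      unfolding power2_norm_eq_inner by (simp add: inner_simps inner_commute)
  qed
  define q where "q n = (norm (p n))\<^sup>2" for n
  have "incseq q"
    unfolding incseq_def q_def using key by (smt (verit) zero_le_power2)
  obtain B where B: "\<And>v. v \<in> E 0 \<Longrightarrow> norm v \<le> B"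
    using assms(5) by (auto simp: bounded_iff)
  have "q n \<le> B\<^sup>2" for n
    unfolding q_def using B[OF sub[of 0 n]] by (intro power_mono) auto
  with \<open>incseq q\<close> have "convergent q"
    by (meson convergent_def incseq_convergent)
  then have qC: "Cauchy q" by (simp add: Cauchy_convergent_iff)
  have "Cauchy p"
  proof (rule metric_CauchyI)
    fix e :: real assume "e > 0"
    then obtain N where N: "\<And>m n. N \<le> m \<Longrightarrow> N \<le> n \<Longrightarrow> dist (q m) (q n) < e\<^sup>2"
      using qC unfolding Cauchy_def by (metis zero_less_power)
    have lt: "norm (p m - p n) < e" if "N \<le> m" "m \<le> n" for m n
    proof -
      have "(norm (p n - p m))\<^sup>2 < e\<^sup>2"
        using key[of m n] N[of m n] that by (simp add: q_def dist_real_def)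
      then show ?thesis
        using \<open>e > 0\<close> by (simp add: norm_minus_commute power_less_imp_less_base)
    qed
    show "\<exists>M. \<forall>m\<ge>M. \<forall>n\<ge>M. dist (p m) (p n) < e"
    proof (intro exI[of _ N] allI impI)
      fix m n assume "N \<le> m" "N \<le> n"
      then show "dist (p m) (p n) < e"
        using lt[of m n] lt[of n m] by (cases "m \<le> n") (auto simp: dist_norm norm_minus_commute)
    qed
  qed
  then obtain y where y: "p \<longlonglongrightarrow> y" by (meson Cauchy_convergent_iff convergent_def)
  have "y \<in> E n" for n
  proof (rule closed_sequentially[OF assms(2)])
    show "\<And>k. p (k + n) \<in> E n" using sub by simp
    show "(\<lambda>k. p (k + n)) \<longlonglongrightarrow> y" using y by (rule LIMSEQ_ignore_initial_segment)
  qed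
  then show ?thesis by blast
qed

text \<open>The Knaster-Kuratowski-Mazurkiewicz principle for convex sets (Granas and Lassonde);
  convexity makes Brouwer's theorem unnecessary.  At a point \<open>y\<close> minimising the largest distance
  to the sets, with \<open>y\<close> in \<open>G a\<close>, moving towards a common point of the other sets would lower
  all distances.\<close>

lemma convex_KKM:
  fixes G :: "'h::real_inner \<Rightarrow> 'h set"
  assumes "finite X" "X \<noteq> {}"
    and "\<And>x. x \<in> X \<Longrightarrow> convex (G x)" "\<And>x. x \<in> X \<Longrightarrow> closed (G x)"
    and "\<And>J. J \<subseteq> X \<Longrightarrow> convex hull J \<subseteq> (\<Union>x\<in>J. G x)"
  shows "convex hull X \<inter> (\<Inter>x\<in>X. G x) \<noteq> {}"
  using assms
proof (induction "card X" arbitrary: X rule: less_induct)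
  case less
  show ?case
  proof (cases "\<exists>x. X = {x}")
    case True
    then obtain x where "X = {x}" by blast
    with less.prems(5)[of "{x}"] show ?thesis by auto
  next
    case False
    have ne: "X - {x} \<noteq> {}" if "x \<in> X" for x using False that by blast
    \<comment> \<open>The induction hypothesis without \<open>x\<close> gives a point common to all
      sets but \<open>G x\<close>. These points span the polytope on which the minimization takes
      place.\<close>
    have "\<exists>y. y \<in> convex hull (X - {x}) \<inter> (\<Inter>z\<in>X - {x}. G z)" if "x \<in> X" for x
    proof -
      have "convex hull (X - {x}) \<inter> (\<Inter>z\<in>X - {x}. G z) \<noteq> {}"
      proof (rule less.hyps)
        show "card (X - {x}) < card X" using that less.prems(1) by (rule card_Diff1_less[rotated])
        show "convex hull J \<subseteq> (\<Union>x\<in>J. G x)" if "J \<subseteq> X - {x}" for J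
          using that by (intro less.prems(5)) blast
      qed (use less.prems ne[OF that] in auto)
      then show ?thesis by blast
    qed
    then obtain y where y: "\<And>x. x \<in> X \<Longrightarrow> y x \<in> convex hull (X - {x}) \<inter> (\<Inter>z\<in>X - {x}. G z)"
      by metis
    define Y where "Y = convex hull (y ` X)"
    have Ysub: "Y \<subseteq> convex hull X"
      unfolding Y_def
    proof (rule hull_minimal)
      show "y ` X \<subseteq> convex hull X"
        using y hull_mono[of "X - {_}" X convex] by fastforce
    qed simp
    have Yc: "compact Y" "convex Y" "Y \<noteq> {}"
      using less.prems by (auto simp: Y_def finite_imp_compact_convex_hull)
    have yY: "y x \<in> Y" if "x \<in> X" for x
      unfolding Y_def using that by (simp add: hull_inc)
    show ?thesis
    proof (rule ccontr)
      assume "\<not> ?thesis"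
      then have emp: "convex hull X \<inter> (\<Inter>x\<in>X. G x) = {}" by simp
      define C where "C x = G x \<inter> Y" for x
      have Cc: "closed (C x)" "convex (C x)" if "x \<in> X" for x
        using less.prems(3,4) that Yc by (auto simp: C_def compact_imp_closed convex_Int)
      have yC: "y z \<in> C x" if "x \<in> X" "z \<in> X" "x \<noteq> z" for x z
        using y[OF that(2)] yY[OF that(2)] that by (auto simp: C_def)
      have Cne: "C x \<noteq> {}" if "x \<in> X" for x
        using yC[OF that] ne[OF that] by blast
      \<comment> \<open>The function to be minimized; it is positive on \<open>Y\<close> as soon as
        the sets have no common point there.\<close>
      define \<phi> where "\<phi> v = Max ((\<lambda>x. infdist v (C x)) ` X)" for v
      have \<phi>_ge: "infdist v (C x) \<le> \<phi> v" if "x \<in> X" for v x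
        unfolding \<phi>_def using that less.prems(1) by (intro Max_ge) auto
      have \<phi>_less: "\<phi> v < c" if "\<And>x. x \<in> X \<Longrightarrow> infdist v (C x) < c" for v c
        unfolding \<phi>_def using that less.prems(1,2) by (subst Max_less_iff) auto
      have "continuous_on Y \<phi>"
      proof -
        have "continuous_on Y (\<lambda>v. Max ((\<lambda>x. infdist v (C x)) ` Z))"
          if "finite Z" "Z \<noteq> {}" for Z
          using that
        proof (induction Z rule: finite_ne_induct)
          case (insert x F)
          have "(\<lambda>v. Max ((\<lambda>x. infdist v (C x)) ` insert x F))
              = (\<lambda>v. max (infdist v (C x)) (Max ((\<lambda>x. infdist v (C x)) ` F)))"
            using insert by auto
          then show ?case
            using insert.IH by (simp only:) (intro continuous_on_max continuous_on_infdist continuous_on_id)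
        qed (simp add: continuous_on_infdist continuous_on_id)
        then show ?thesis
          unfolding \<phi>_def using less.prems(1,2) .
      qed
      then obtain w where w: "w \<in> Y" "\<And>v. v \<in> Y \<Longrightarrow> \<phi> w \<le> \<phi> v"
        using continuous_attains_inf[OF Yc(1,3)] by metis
      \<comment> \<open>The covering condition for \<open>J = X\<close>.\<close>
      obtain a where a: "a \<in> X" "w \<in> G a"
        using less.prems(5)[of X] w(1) Ysub by blast
      have "w \<in> C a" using a w by (simp add: C_def)
      have pos: "0 < \<phi> w"
      proof -
        obtain x where x: "x \<in> X" "w \<notin> G x" using emp w(1) Ysub by blast
        then have "0 < infdist w (C x)"
          using Cc Cne by (intro infdist_pos_not_in_closed) (auto simp: C_def)
        with \<phi>_ge[OF x(1), of w] show ?thesis by linarith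
      qed
      \<comment> \<open>The summand 1 keeps \<open>D\<close> positive even when
        \<open>y a = w\<close>. The choice of \<open>t\<close> makes the displacement smaller than
        \<open>\<phi> w\<close>, which handles the set \<open>C a\<close> containing
        \<open>w\<close>, and keeps \<open>1 - t\<close> positive.\<close>
      define D where "D = norm (y a - w) + 1"
      have D: "D > 0" by (simp add: D_def add_nonneg_pos)
      define t where "t = min (1/2) (\<phi> w / (2 * D))"
      have t: "0 < t" "t \<le> 1/2" "t * D \<le> \<phi> w / 2"
      proof -
        show "0 < t" "t \<le> 1/2" using pos D by (auto simp: t_def)
        have "t * D \<le> \<phi> w / (2 * D) * D"
          using D by (intro mult_right_mono) (auto simp: t_def)
        then show "t * D \<le> \<phi> w / 2" using D by simp
      qed
      define v where "v = (1 - t) *\<^sub>R w + t *\<^sub>R y a"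
      have vY: "v \<in> Y" unfolding v_def
        using Yc(2) w(1) yY[OF a(1)] t by (intro convexD) auto
      have "\<phi> v < \<phi> w"
      proof (rule \<phi>_less)
        fix x assume x: "x \<in> X"
        show "infdist v (C x) < \<phi> w"
        proof (cases "x = a")
          case True
          have "infdist v (C x) \<le> dist v w" using True \<open>w \<in> C a\<close> by (simp add: infdist_le)
          also have "v - w = t *\<^sub>R (y a - w)" by (simp add: v_def algebra_simps)
          then have "dist v w = t * norm (y a - w)" using t by (simp add: dist_norm)
          also have "\<dots> \<le> t * D" using t by (intro mult_left_mono) (auto simp: D_def)
          also have "\<dots> < \<phi> w" using t pos by linarith
          finally show ?thesis .
        next
          case False
          \<comment> \<open>As \<open>y a\<close> belongs to the convex set \<open>C x\<close>, the
            contraction with centre \<open>y a\<close> and factor \<open>1 - t\<close> maps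
            \<open>C x\<close> into itself and \<open>w\<close> to \<open>v\<close>.\<close>
          have "infdist v (C x) \<le> (1 - t) * infdist w (C x)"
          proof -
            have "infdist v (C x) / (1 - t) \<le> infdist w (C x)"
              unfolding infdist_notempty[OF Cne[OF x], of w]
            proof (rule cINF_greatest[OF Cne[OF x]])
              fix b assume b: "b \<in> C x"
              have "(1 - t) *\<^sub>R b + t *\<^sub>R y a \<in> C x"
                using Cc(2)[OF x] b yC[OF x a(1) False] t by (intro convexD) auto
              then have "infdist v (C x) \<le> dist v ((1 - t) *\<^sub>R b + t *\<^sub>R y a)" by (rule infdist_le)
              also have "v - ((1 - t) *\<^sub>R b + t *\<^sub>R y a) = (1 - t) *\<^sub>R (w - b)"
                by (simp add: v_def algebra_simps)
              then have "dist v ((1 - t) *\<^sub>R b + t *\<^sub>R y a) = (1 - t) * dist w b"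
                using t by (simp add: dist_norm)
              finally show "infdist v (C x) / (1 - t) \<le> dist w b"
                using t by (simp add: field_simps)
            qed
            then show ?thesis using t by (simp add: field_simps)
          qed
          also have "\<dots> \<le> (1 - t) * \<phi> w"
            using t \<phi>_ge[OF x] by (intro mult_left_mono) auto
          also have "\<dots> < \<phi> w" using t pos by simp
          finally show ?thesis .
        qed
      qed
      with w(2)[OF vY] show False by simp
    qed
  qed
qed

section \<open>Variational inequalities\<close>

definition solves_VI :: "'h::real_inner set \<Rightarrow> ('h \<Rightarrow> 'h) \<Rightarrow> 'h \<Rightarrow> bool" where
  "solves_VI C F y \<longleftrightarrow> y \<in> C \<and> (\<forall>v\<in>C. inner (F y) (v - y) \<ge> 0)"

text \<open>A limit of Minty's inequality \<open>\<langle>F z, z - y\<rangle> \<ge> 0\<close> along \<open>z = y + t (v - y)\<close>.\<close>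

lemma Minty_imp_solves_VI:
  assumes "convex C" "continuous_on C F" "y \<in> C"
    and "\<And>z. z \<in> C \<Longrightarrow> inner (F z) (z - y) \<ge> 0"
  shows "solves_VI C F y"
  unfolding solves_VI_def
proof (intro conjI ballI)
  fix v assume v: "v \<in> C"
  define z where "z n = y + (1 / real (Suc n)) *\<^sub>R (v - y)" for n
  have zC: "z n \<in> C" for n
  proof -
    have "z n = (1 - 1 / real (Suc n)) *\<^sub>R y + (1 / real (Suc n)) *\<^sub>R v"
      by (simp add: z_def algebra_simps)
    also have "\<dots> \<in> C" using assms(1,3) v by (intro convexD) auto
    finally show ?thesis .
  qed
  have "(\<lambda>n. 1 / real (Suc n)) \<longlonglongrightarrow> 0" by (rule LIMSEQ_Suc[OF lim_const_over_n])
  then have "z \<longlonglongrightarrow> y + 0 *\<^sub>R (v - y)"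
    unfolding z_def by (intro tendsto_intros)
  then have "(\<lambda>n. F (z n)) \<longlonglongrightarrow> F y"
    using assms(2,3) zC by (auto simp: continuous_on_sequentially o_def)
  then have "(\<lambda>n. inner (F (z n)) (v - y)) \<longlonglongrightarrow> inner (F y) (v - y)"
    by (intro tendsto_intros)
  moreover have "inner (F (z n)) (v - y) \<ge> 0" for n
    using assms(4)[OF zC[of n]] by (simp add: z_def zero_le_mult_iff zero_le_divide_iff)
  ultimately show "inner (F y) (v - y) \<ge> 0"
    by (intro LIMSEQ_le_const) auto
qed (rule assms(3))

lemma strongly_pseudomonotone_VI_exists:
  fixes C :: "'h::{real_inner, banach, second_countable_topology} set"
  assumes C: "convex C" "closed C" "C \<noteq> {}"
    and F: "strongly_pseudomonotone_on m C F" "continuous_on C F"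
  obtains y where "solves_VI C F y"
proof -
  have m: "m > 0"
    and pm: "\<And>y z. y \<in> C \<Longrightarrow> z \<in> C \<Longrightarrow> inner (F y) (z - y) \<ge> 0
      \<Longrightarrow> inner (F z) (z - y) \<ge> m * (norm (z - y))\<^sup>2"
    using F(1) by (auto simp: strongly_pseudomonotone_on_def)
  define G where "G z = {y. inner (F z) (z - y) \<ge> m * (norm (z - y))\<^sup>2}" for z
  \<comment> \<open>Completing the square. The ball form makes the sets convex, closed and
    bounded.\<close>
  have G_ball: "G z = cball (z - (1 / (2 * m)) *\<^sub>R F z) (norm (F z) / (2 * m))" for z
  proof -
    have "inner (F z) (z - y) \<ge> m * (norm (z - y))\<^sup>2
      \<longleftrightarrow> dist (z - (1 / (2 * m)) *\<^sub>R F z) y \<le> norm (F z) / (2 * m)" for y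
    proof -
      have "dist (z - (1 / (2 * m)) *\<^sub>R F z) y \<le> norm (F z) / (2 * m)
        \<longleftrightarrow> (norm ((z - y) - (1 / (2 * m)) *\<^sub>R F z))\<^sup>2 \<le> (norm (F z) / (2 * m))\<^sup>2"
        using m by (subst abs_le_square_iff[symmetric]) (simp add: dist_norm algebra_simps)
      also have "(norm ((z - y) - (1 / (2 * m)) *\<^sub>R F z))\<^sup>2
        = (norm (z - y))\<^sup>2 - inner (F z) (z - y) / m + (norm (F z) / (2 * m))\<^sup>2"
      proof -
        have *: "(norm (a - c *\<^sub>R b))\<^sup>2 = (norm a)\<^sup>2 - 2 * c * inner b a + c\<^sup>2 * (norm b)\<^sup>2"
          for a b :: 'h and c
          unfolding power2_norm_eq_inner
          by (simp add: inner_diff inner_commute power2_eq_square algebra_simps)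
        show ?thesis unfolding * using m by (simp add: power_divide)
      qed
      finally show ?thesis using m by (simp add: field_simps)
    qed
    then show ?thesis unfolding G_def by (intro set_eqI) (simp only: mem_Collect_eq mem_cball)
  qed
  \<comment> \<open>If a convex combination \<open>y\<close> lay in no \<open>G x\<close>, strong
    pseudomonotonicity would force \<open>inner (F y) (x - y) < 0\<close> for every \<open>x\<close>
    in \<open>J\<close>, although the weighted mean of these numbers is
    \<open>inner (F y) (y - y) = 0\<close>.\<close>
  have KKM: "convex hull J \<subseteq> (\<Union>x\<in>J. G x)" if J: "J \<subseteq> C" "finite J" for J
  proof
    fix y assume y: "y \<in> convex hull J"
    then obtain u where u: "\<And>x. x \<in> J \<Longrightarrow> 0 \<le> u x" "sum u J = 1" "(\<Sum>x\<in>J. u x *\<^sub>R x) = y"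
      unfolding convex_hull_finite[OF J(2)] by blast
    have "y \<in> C" using y J(1) C(1) by (meson hull_minimal in_mono)
    show "y \<in> (\<Union>x\<in>J. G x)"
    proof (rule ccontr)
      assume "y \<notin> (\<Union>x\<in>J. G x)"
      then have neg: "inner (F y) (x - y) < 0" if "x \<in> J" for x
        using pm[OF \<open>y \<in> C\<close>, of x] that J(1) by (force simp: G_def)
      have "(\<Sum>x\<in>J. u x * inner (F y) (x - y)) = inner (F y) ((\<Sum>x\<in>J. u x *\<^sub>R x) - (\<Sum>x\<in>J. u x) *\<^sub>R y)"
        by (simp add: inner_sum_right inner_diff_right scaleR_sum_left right_diff_distrib sum_subtractf)
      also have "\<dots> = 0" using u by simp
      finally have 0: "(\<Sum>x\<in>J. - (u x * inner (F y) (x - y))) = 0" by (simp add: sum_negf)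
      have "- (u x * inner (F y) (x - y)) = 0" if "x \<in> J" for x
        using 0 that J(2) u(1) neg
        by (subst (asm) sum_nonneg_eq_0_iff) (auto simp: mult_nonneg_nonpos less_imp_le)
      then have "u x = 0" if "x \<in> J" for x using neg that by fastforce
      then show False using u(2) by simp
    qed
  qed
  \<comment> \<open>A dense sequence of test points suffices, because the inequality is continuous
    in the test point; only decreasing sequences are covered by the intersection lemma.\<close>
  obtain Q where Q: "countable Q" "Q \<subseteq> C" "C \<subseteq> closure Q"
    using separable by metis
  then have "Q \<noteq> {}" using C(3) by auto
  then obtain z :: "nat \<Rightarrow> 'h" where z: "range z = Q" using Q(1) by (metis range_from_nat_into)
  have zC: "z n \<in> C" for n using z Q(2) by blast
  define E where "E n = C \<inter> (\<Inter>k\<le>n. G (z k))" for n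
  have "(\<Inter>n. E n) \<noteq> {}"
  proof (rule decseq_convex_Inter_nonempty)
    show "convex (E n)" "closed (E n)" for n
      using C by (auto simp: E_def G_ball intro!: convex_Int convex_INT closed_Int closed_INT)
    show "E n \<noteq> {}" for n
    proof -
      have "convex hull (z ` {..n}) \<inter> (\<Inter>x\<in>z ` {..n}. G x) \<noteq> {}"
      proof (rule convex_KKM)
        show "convex hull J \<subseteq> (\<Union>x\<in>J. G x)" if "J \<subseteq> z ` {..n}" for J
          using that zC by (intro KKM) (auto intro: finite_subset)
      qed (auto simp: G_ball)
      moreover have "convex hull (z ` {..n}) \<subseteq> C"
        using zC C(1) by (intro hull_minimal) auto
      ultimately show ?thesis by (auto simp: E_def)
    qed
    show "decseq E" by (force simp: E_def decseq_def)
    show "bounded (E 0)" by (auto simp: E_def G_ball)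
  qed
  then obtain y where y: "\<And>n. y \<in> E n" by blast
  have yC: "y \<in> C" using y by (auto simp: E_def)
  have "inner (F x) (x - y) \<ge> m * (norm (x - y))\<^sup>2" if "x \<in> C" for x
  proof -
    have "x \<in> closure Q" using that Q by blast
    then obtain a where a: "\<And>n. a n \<in> Q" "a \<longlonglongrightarrow> x" by (meson closure_sequential)
    have "(\<lambda>n. F (a n)) \<longlonglongrightarrow> F x"
      using F(2) a Q(2) that by (auto simp: continuous_on_sequentially o_def)
    then have "(\<lambda>n. inner (F (a n)) (a n - y)) \<longlonglongrightarrow> inner (F x) (x - y)"
      "(\<lambda>n. m * (norm (a n - y))\<^sup>2) \<longlonglongrightarrow> m * (norm (x - y))\<^sup>2"
      using a(2) by (auto intro!: tendsto_intros)
    moreover have "m * (norm (a n - y))\<^sup>2 \<le> inner (F (a n)) (a n - y)" for n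
    proof -
      obtain k where "a n = z k" using a(1)[of n] z by blast
      with y[of k] show ?thesis by (auto simp: E_def G_def)
    qed
    ultimately show ?thesis by (meson LIMSEQ_le)
  qed
  then have "inner (F x) (x - y) \<ge> 0" if "x \<in> C" for x
    using that m by (meson mult_nonneg_nonneg order_trans less_imp_le zero_le_power2)
  then show thesis using Minty_imp_solves_VI[OF C(1) F(2) yC] that by blast
qed

text \<open>The inequality for \<open>y1\<close> tested with \<open>y2\<close> is upgraded to one
  for \<open>F1 y2\<close> and then added to the inequality for \<open>y2\<close> tested with
  \<open>y1\<close>. The operators are compared at \<open>y2\<close> alone; with equal operators
  this is uniqueness.\<close>

lemma strongly_pseudomonotone_VI_stability:
  assumes "strongly_pseudomonotone_on m C F1" "solves_VI C F1 y1" "solves_VI C F2 y2"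
  shows "norm (y1 - y2) \<le> norm (F1 y2 - F2 y2) / m"
proof -
  have m: "m > 0" and y: "y1 \<in> C" "y2 \<in> C"
    using assms by (auto simp: strongly_pseudomonotone_on_def solves_VI_def)
  have "inner (F1 y2) (y2 - y1) \<ge> m * (norm (y2 - y1))\<^sup>2" "inner (F2 y2) (y1 - y2) \<ge> 0"
    using assms y by (auto simp: strongly_pseudomonotone_on_def solves_VI_def)
  then have "m * (norm (y2 - y1))\<^sup>2 \<le> inner (F1 y2 - F2 y2) (y2 - y1)"
    by (simp add: inner_simps)
  also have "\<dots> \<le> norm (F1 y2 - F2 y2) * norm (y2 - y1)" by (rule norm_cauchy_schwarz)
  finally have "m * norm (y2 - y1) \<le> norm (F1 y2 - F2 y2)"
    by (cases "y2 = y1") (auto simp: power2_eq_square)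
  then show ?thesis using m by (simp add: field_simps norm_minus_commute)
qed

text \<open>The comparison point \<open>metric_proj C (y\<^sub>0 - F\<^sub>0 y\<^sub>0)\<close> lies in \<open>C\<close> and equals \<open>y\<^sub>0\<close> when
  \<open>C = C\<^sub>0\<close>, because \<open>y\<^sub>0\<close> is a fixed point of the projected step.\<close>

lemma VI_stability_moving_set:
  fixes C :: "'h::{real_inner, banach} set"
  assumes C: "convex C" "closed C"
    and F: "strongly_pseudomonotone_on m C F" "L-lipschitz_on UNIV F"
    and y: "solves_VI C F y"
    and p: "p = metric_proj C (y0 - F0 y0)"
  shows "norm (y - y0) \<le> (1 + (L + 1) / m) * norm (p - y0) + norm (F y0 - F0 y0) / m"
proof -
  have m: "m > 0" and yC: "y \<in> C" using F y by (auto simp: strongly_pseudomonotone_on_def solves_VI_def)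
  then have pC: "p \<in> C" unfolding p by (intro metric_proj_in C) auto
  have 1: "inner (F p) (p - y) \<ge> m * (norm (p - y))\<^sup>2"
    using F(1) y pC by (auto simp: strongly_pseudomonotone_on_def solves_VI_def)
  have 2: "inner (y0 - F0 y0 - p) (y - p) \<le> 0"
    unfolding p by (rule metric_proj_dot[OF C yC])
  \<comment> \<open>Strong pseudomonotonicity at \<open>p\<close> plus the projection inequality
    tested with \<open>y\<close>. Passing from \<open>F p\<close> to \<open>F y0\<close> costs
    \<open>L\<close>, and the term \<open>p - y0\<close> costs 1, hence \<open>(L + 1) / m\<close>;
    the other 1 in the claim is the way from \<open>p\<close> back to \<open>y0\<close>.\<close>
  have "m * (norm (p - y))\<^sup>2 \<le> inner (F p - F0 y0 - (p - y0)) (p - y)"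
    using 1 2 by (simp add: inner_simps algebra_simps)
  also have "\<dots> \<le> norm (F p - F0 y0 - (p - y0)) * norm (p - y)" by (rule norm_cauchy_schwarz)
  finally have "m * norm (p - y) \<le> norm (F p - F0 y0 - (p - y0))"
    by (cases "p = y") (auto simp: power2_eq_square)
  also have "F p - F0 y0 - (p - y0) = (F p - F y0) + (F y0 - F0 y0) + (y0 - p)" by simp
  then have "norm (F p - F0 y0 - (p - y0)) \<le> norm (F p - F y0) + norm (F y0 - F0 y0) + norm (y0 - p)"
    using norm_triangle_ineq[of "(F p - F y0) + (F y0 - F0 y0)" "y0 - p"]
      norm_triangle_ineq[of "F p - F y0" "F y0 - F0 y0"] by (simp only:)
  also have "norm (F p - F y0) \<le> L * norm (p - y0)"
    using lipschitz_onD[OF F(2), of p y0] by (simp add: dist_norm)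
  finally have "norm (p - y) \<le> ((L + 1) * norm (p - y0) + norm (F y0 - F0 y0)) / m"
    using m by (simp add: field_simps norm_minus_commute)
  moreover have "norm (y - y0) \<le> norm (p - y) + norm (p - y0)"
    using norm_triangle_ineq4[of "p - y0" "p - y"] by simp
  moreover have "((L + 1) * norm (p - y0) + norm (F y0 - F0 y0)) / m
      = (L + 1) / m * norm (p - y0) + norm (F y0 - F0 y0) / m"
    by (subst add_divide_distrib) (simp only: times_divide_eq_left)
  moreover have "(1 + (L + 1) / m) * norm (p - y0) = norm (p - y0) + (L + 1) / m * norm (p - y0)"
    by (simp only: distrib_right mult_1_left)
  ultimately show ?thesis by linarith
qed

text \<open>For \<open>z = y - F y\<close> the vector \<open>z - y\<close> is \<open>- F y\<close>,
  so the variational inequality is the obtuse-angle characterization of the projection.\<close>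

lemma solves_VI_metric_proj:
  fixes C :: "'h::{real_inner, banach} set"
  assumes "convex C" "closed C" "solves_VI C F y"
  shows "metric_proj C (y - F y) = y"
  using assms by (intro metric_proj_eqI) (auto simp: solves_VI_def)

text \<open>Coercivity gives \<open>c * norm x \<le> norm (P x)\<close>, hence injectivity and the
  constant \<open>1 / c\<close> for the inverse. Surjectivity is the existence theorem on the whole
  space: \<open>x \<mapsto> P x - y\<close> is strongly pseudomonotone with modulus
  \<open>c\<close>.\<close>

lemma coercive_bij:
  fixes P :: "'h::{real_inner, banach, second_countable_topology} \<Rightarrow> 'h"
  assumes "bounded_linear P" "coercive P"
  obtains c where "c > 0" "\<And>y. P (inv P y) = y" "\<And>x. inv P (P x) = x"
    "\<And>y1 y2. norm (inv P y1 - inv P y2) \<le> norm (y1 - y2) / c"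
proof -
  interpret P: bounded_linear P by fact
  obtain c where c: "c > 0" "\<And>x. inner (P x) x \<ge> c * (norm x)\<^sup>2"
    using assms(2) by (auto simp: coercive_def)
  have low: "c * norm x \<le> norm (P x)" for x
  proof (cases "x = 0")
    case False
    have "c * (norm x)\<^sup>2 \<le> norm (P x) * norm x"
      using c(2)[of x] norm_cauchy_schwarz[of "P x" x] by linarith
    then show ?thesis using False by (simp add: power2_eq_square)
  qed (simp add: P.zero)
  have "inj P"
    using low c(1) by (subst P.linear_axioms[THEN linear_injective_0])
      (metis P.zero norm_zero mult_le_0_iff norm_le_zero_iff not_le)
  have "surj P"
  proof -
    have "\<exists>x. P x = y" for y
    proof -
      define F where "F x = P x - y" for x
      have "strongly_pseudomonotone_on c UNIV F"
        unfolding strongly_pseudomonotone_on_def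
      proof (intro conjI ballI impI)
        fix x z assume "0 \<le> inner (F x) (z - x)"
        moreover have "inner (F z) (z - x) = inner (F x) (z - x) + inner (P (z - x)) (z - x)"
          by (simp add: F_def P.diff inner_simps)
        ultimately show "c * (norm (z - x))\<^sup>2 \<le> inner (F z) (z - x)" using c(2)[of "z - x"] by simp
      qed (rule c(1))
      moreover have "continuous_on UNIV F"
        unfolding F_def by (intro continuous_intros P.continuous_on)
      ultimately obtain x where "solves_VI UNIV F x"
        using strongly_pseudomonotone_VI_exists[of UNIV c F] by auto
      then have "inner (F x) (v - x) \<ge> 0" for v by (simp add: solves_VI_def)
      \<comment> \<open>This test point gives \<open>- (norm (F x))^2 \<ge> 0\<close>.\<close>
      from this[of "x - F x"] have "F x = 0"
        by (metis add_diff_cancel_left' diff_add_cancel inner_eq_zero_iff inner_ge_zero inner_minus_right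
            minus_diff_eq neg_0_le_iff_le order_antisym)
      then show ?thesis by (auto simp: F_def)
    qed
    then show ?thesis by (simp add: surj_def) (metis (no_types))
  qed
  show thesis
  proof
    show s: "P (inv P y) = y" for y using \<open>surj P\<close> by (simp add: surj_f_inv_f)
    show "inv P (P x) = x" for x using \<open>inj P\<close> by simp
    show "norm (inv P y1 - inv P y2) \<le> norm (y1 - y2) / c" for y1 y2
      using low[of "inv P y1 - inv P y2"] c(1) by (simp add: P.diff s field_simps)
  qed (rule c(1))
qed

section \<open>Strongly continuous semigroups\<close>

text \<open>Banach-Steinhaus by Baire: the closed sets \<open>C k\<close> cover the space, so one of
  them contains a ball, and differences of points in that ball, rescaled, control all
  directions.\<close>

lemma uniform_boundedness:
  fixes F :: "nat \<Rightarrow> 'a::banach \<Rightarrow> 'b::real_normed_vector"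
  assumes lin: "\<And>n. bounded_linear (F n)" and bdd: "\<And>x. bounded (range (\<lambda>n. F n x))"
  obtains M where "\<And>n x. norm (F n x) \<le> M * norm x"
proof -
  define C where "C k = {x. \<forall>n. norm (F n x) \<le> real k}" for k :: nat
  have closed: "closed (C k)" for k
  proof -
    have "C k = (\<Inter>n. {x. norm (F n x) \<le> real k})" by (auto simp: C_def)
    moreover have "closed {x. norm (F n x) \<le> real k}" for n
      using lin by (intro closed_Collect_le continuous_intros linear_continuous_on)
    ultimately show ?thesis by auto
  qed
  have "(\<Union>k. C k) = UNIV"
  proof -
    have "\<exists>k. x \<in> C k" for x
    proof -
      obtain b where "\<And>n. norm (F n x) \<le> b" using bdd[of x] by (auto simp: bounded_iff)
      moreover obtain k where "b \<le> real k" by (meson real_arch_simple)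
      ultimately show ?thesis unfolding C_def by (blast intro: order_trans)
    qed
    then show ?thesis by blast
  qed
  then have "\<not> (euclidean interior_of (\<Union>(range C)) = {})" by simp
  then have "\<exists>k. interior (C k) \<noteq> {}"
    using Baire_category_alt[of "euclidean :: 'a topology" "range C"] closed
    by (auto simp: completely_metrizable_space_euclidean)
  then obtain k a where "a \<in> interior (C k)" by blast
  then obtain r where r: "r > 0" "cball a r \<subseteq> C k"
    by (meson mem_interior_cball)
  have "norm (F n x) \<le> (2 * k / r) * norm x" for n x
  proof -
    interpret bounded_linear "F n" by (rule lin)
    show ?thesis
    proof (cases "x = 0")
      case True
      then show ?thesis by (simp add: zero)
    next
      case False
      have "a + (r / norm x) *\<^sub>R x \<in> C k" "a \<in> C k"
        using r False by (auto intro!: subsetD[OF r(2)] simp: dist_norm)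
      then have "norm (F n (a + (r / norm x) *\<^sub>R x)) \<le> k" "norm (F n a) \<le> k"
        by (auto simp: C_def)
      then have "norm (F n (a + (r / norm x) *\<^sub>R x) - F n a) \<le> 2 * k"
        using norm_triangle_ineq4[of "F n (a + (r / norm x) *\<^sub>R x)" "F n a"] by linarith
      also have "F n (a + (r / norm x) *\<^sub>R x) - F n a = (r / norm x) *\<^sub>R F n x"
        by (simp add: add scaleR)
      finally show ?thesis using r False by (simp add: field_simps)
    qed
  qed
  then show thesis using that by blast
qed

text \<open>Unboundedness near 0 would produce times \<open>\<tau> n\<close> tending to 0 with large
  operator norms, against uniform boundedness, since the orbits converge. The semigroup law then
  carries the bound from \<open>[0, \<delta>)\<close> to \<open>[0, T]\<close> in
  \<open>N > T / \<delta>\<close> steps.\<close>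

lemma C0_semigroup_bounded:
  fixes S :: "real \<Rightarrow> 'h::banach \<Rightarrow> 'h"
  assumes "C0_semigroup S"
  obtains M where "M \<ge> 1" "\<And>t x. t \<in> {0..T} \<Longrightarrow> norm (S t x) \<le> M * norm x"
proof -
  have lin: "\<And>t. t \<ge> 0 \<Longrightarrow> bounded_linear (S t)" and S0: "\<And>x. S 0 x = x"
    and comp: "\<And>s t x. s \<ge> 0 \<Longrightarrow> t \<ge> 0 \<Longrightarrow> S (s + t) x = S s (S t x)"
    and lim: "\<And>x. ((\<lambda>t. S t x) \<longlongrightarrow> x) (at_right 0)"
    using assms by (auto simp: C0_semigroup_def)
  have "\<exists>M \<delta>. \<delta> > 0 \<and> (\<forall>t\<in>{0<..<\<delta>}. \<forall>x. norm (S t x) \<le> M * norm x)"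
  proof (rule ccontr)
    assume "\<not> ?thesis"
    then have "\<exists>t\<in>{0<..<1 / real (Suc n)}. \<exists>x. norm (S t x) > real n * norm x" for n
      by (metis not_le of_nat_0_less_iff zero_less_Suc zero_less_divide_1_iff)
    then obtain \<tau> where \<tau>: "\<And>n. \<tau> n \<in> {0<..<1 / real (Suc n)}"
      and big: "\<And>n. \<exists>x. norm (S (\<tau> n) x) > real n * norm x"
      by metis
    have "\<tau> \<longlonglongrightarrow> 0"
    proof (rule tendsto_sandwich[of "\<lambda>_. 0" \<tau> sequentially "\<lambda>n. 1 / real (Suc n)"])
      show "(\<lambda>n. 1 / real (Suc n)) \<longlonglongrightarrow> 0" by (rule LIMSEQ_Suc[OF lim_const_over_n])
      show "\<forall>\<^sub>F n in sequentially. 0 \<le> \<tau> n" "\<forall>\<^sub>F n in sequentially. \<tau> n \<le> 1 / real (Suc n)"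
        using \<tau> by (auto intro!: always_eventually less_imp_le simp del: of_nat_Suc)
    qed simp
    then have "filterlim \<tau> (at_right 0) sequentially"
    proof -
      have "\<tau> n \<in> {0<..} \<and> \<tau> n \<noteq> 0" for n using \<tau>[of n] by auto
      with \<open>\<tau> \<longlonglongrightarrow> 0\<close> show ?thesis unfolding filterlim_at by (intro conjI always_eventually) auto
    qed
    then have "(\<lambda>n. S (\<tau> n) x) \<longlonglongrightarrow> x" for x
      using lim[of x] by (rule filterlim_compose[rotated])
    then have "bounded (range (\<lambda>n. S (\<tau> n) x))" for x
      using convergent_imp_bounded by blast
    moreover have "bounded_linear (S (\<tau> n))" for n
      using \<tau>[of n] by (intro lin) auto
    ultimately obtain M where M: "\<And>n x. norm (S (\<tau> n) x) \<le> M * norm x"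
      using uniform_boundedness[of "\<lambda>n. S (\<tau> n)"] by metis
    obtain n where n: "M \<le> real n" by (meson real_arch_simple)
    obtain x where "norm (S (\<tau> n) x) > real n * norm x" using big by blast
    moreover have "norm (S (\<tau> n) x) \<le> real n * norm x"
      using M[of n x] mult_right_mono[OF n norm_ge_zero[of x]] by linarith
    ultimately show False by simp
  qed
  then obtain M0 \<delta> where \<delta>: "\<delta> > 0" and M0: "\<And>t x. t \<in> {0<..<\<delta>} \<Longrightarrow> norm (S t x) \<le> M0 * norm x"
    by blast
  \<comment> \<open>The maximum with 1 covers \<open>t = 0\<close>, where \<open>S 0\<close> is the
    identity, and yields \<open>M ^ N \<ge> 1\<close>.\<close>
  define M where "M = max 1 M0"
  have M: "norm (S t x) \<le> M * norm x" if "0 \<le> t" "t < \<delta>" for t x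
  proof (cases "t = 0")
    case True
    have "1 * norm x \<le> M * norm x" by (intro mult_right_mono) (auto simp: M_def)
    then show ?thesis using True S0 by simp
  next
    case False
    have "M0 * norm x \<le> M * norm x" by (intro mult_right_mono) (auto simp: M_def)
    then show ?thesis using M0[of t x] False that by force
  qed
  obtain N :: nat where N: "T / \<delta> < real N" using reals_Archimedean2 by blast
  have "N > 0 \<or> T < 0" using N \<delta> by (cases "N = 0") (auto simp: field_simps)
  have pow: "norm (S (real n * s) x) \<le> M ^ n * norm x" if "0 \<le> s" "s < \<delta>" for n s x
  proof (induction n)
    case (Suc n)
    have "S (real (Suc n) * s) x = S s (S (real n * s) x)"
      using comp[of s "real n * s" x] that by (simp add: algebra_simps)
    also have "norm \<dots> \<le> M * norm (S (real n * s) x)" using that by (intro M)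
    also have "\<dots> \<le> M * (M ^ n * norm x)" using Suc by (intro mult_left_mono) (auto simp: M_def)
    finally show ?case by simp
  qed (simp add: S0)
  have "norm (S t x) \<le> M ^ N * norm x" if "t \<in> {0..T}" for t x
  proof -
    have "N > 0" using \<open>N > 0 \<or> T < 0\<close> that by auto
    have "t / real N < \<delta>" using N \<open>N > 0\<close> \<delta> that by (auto simp: field_simps)
    from pow[OF _ this, of N x] show ?thesis using \<open>N > 0\<close> that by simp
  qed
  moreover have "M ^ N \<ge> 1" by (simp add: M_def one_le_power)
  ultimately show thesis using that by blast
qed

text \<open>Only right continuity at 0 is given. Factoring out the semigroup at the earlier of two
  times, and bounding it uniformly by \<open>M\<close>, gives continuity from both sides.\<close>

lemma C0_semigroup_continuous:
  fixes S :: "real \<Rightarrow> 'h::banach \<Rightarrow> 'h"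
  assumes S: "C0_semigroup S"
  shows "continuous_on {0..T} (\<lambda>t. S t x)"
proof -
  have lin: "\<And>t. t \<ge> 0 \<Longrightarrow> bounded_linear (S t)" and S0: "\<And>x. S 0 x = x"
    and comp: "\<And>s t x. s \<ge> 0 \<Longrightarrow> t \<ge> 0 \<Longrightarrow> S (s + t) x = S s (S t x)"
    and lim: "((\<lambda>t. S t x) \<longlongrightarrow> x) (at_right 0)"
    using S by (auto simp: C0_semigroup_def)
  obtain M where M: "M \<ge> 1" "\<And>t x. t \<in> {0..T} \<Longrightarrow> norm (S t x) \<le> M * norm x"
    using C0_semigroup_bounded[OF S] by metis
  have step: "norm (S t x - S s x) \<le> M * norm (S (t - s) x - x)" if "0 \<le> s" "s \<le> t" "t \<le> T" for s t
  proof -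
    interpret bounded_linear "S s" using that by (intro lin)
    have "S t x - S s x = S s (S (t - s) x - x)"
      using comp[of s "t - s" x] that by (simp add: diff)
    then show ?thesis using M(2)[of s] that by simp
  qed
  show ?thesis
    unfolding continuous_on_iff
  proof (intro ballI allI impI)
    fix s e :: real assume s: "s \<in> {0..T}" and e: "e > 0"
    have "\<forall>\<^sub>F t in at_right 0. dist (S t x) x < e / M"
      using tendstoD[OF lim, of "e / M"] e M(1) by simp
    then obtain d where d: "d > 0" "\<And>t. 0 < t \<Longrightarrow> t < d \<Longrightarrow> norm (S t x - x) < e / M"
      by (auto simp: eventually_at_right_field dist_norm)
    have d': "M * norm (S t x - x) < e" if "0 \<le> t" "t < d" for t
      using d(2)[of t] that S0[of x] e M(1) by (cases "t = 0") (auto simp: field_simps)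
    show "\<exists>d>0. \<forall>t\<in>{0..T}. dist t s < d \<longrightarrow> dist (S t x) (S s x) < e"
    proof (intro exI[of _ d] conjI ballI impI d(1))
      fix t assume t: "t \<in> {0..T}" "dist t s < d"
      show "dist (S t x) (S s x) < e"
        using step[of s t] step[of t s] d'[of "t - s"] d'[of "s - t"] s t
        by (cases "s \<le> t") (auto simp: dist_norm norm_minus_commute)
    qed
  qed
qed

section \<open>Measurability and integration\<close>

text \<open>With \<open>g\<close> replaced by a simple function, finitely many measurable sections
  are patched together; continuity in the second argument passes to the limit.\<close>

lemma caratheodory_measurable:
  fixes G :: "'a \<Rightarrow> 'z::{metric_space, second_countable_topology} \<Rightarrow> 'b::metric_space"
  assumes meas: "\<And>z. (\<lambda>s. G s z) \<in> borel_measurable M"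
    and cont: "\<And>s. s \<in> space M \<Longrightarrow> continuous_on UNIV (G s)"
    and g: "g \<in> borel_measurable M"
  shows "(\<lambda>s. G s (g s)) \<in> borel_measurable M"
proof -
  obtain \<phi> where \<phi>: "\<And>i. simple_function M (\<phi> i)" "\<And>s. s \<in> space M \<Longrightarrow> (\<lambda>i. \<phi> i s) \<longlonglongrightarrow> g s"
    using borel_measurable_implies_sequence_metric[OF g] by blast
  show ?thesis
  proof (rule borel_measurable_LIMSEQ_metric)
    show "(\<lambda>s. G s (\<phi> i s)) \<in> borel_measurable M" for i
    proof (rule measurable_compose_countable'[where I = "\<phi> i ` space M" and f = "\<lambda>z s. G s z"])
      show "\<phi> i \<in> measurable M (count_space (\<phi> i ` space M))"
        using measurable_simple_function[OF \<phi>(1)[of i]]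
        by (auto simp: measurable_def)
      show "countable (\<phi> i ` space M)"
        using \<phi>(1)[of i] by (auto simp: simple_function_def countable_finite)
    qed (rule meas)
    show "(\<lambda>i. G s (\<phi> i s)) \<longlonglongrightarrow> G s (g s)" if "s \<in> space M" for s
      using cont[OF that] \<phi>(2)[OF that] by (auto simp: continuous_on_sequentially o_def)
  qed
qed

lemma set_integrable_bounded:
  fixes f :: "real \<Rightarrow> 'b::{banach, second_countable_topology}"
  assumes "f \<in> borel_measurable (lebesgue_on {a..b})" "\<And>s. s \<in> {a..b} \<Longrightarrow> norm (f s) \<le> B"
  shows "set_integrable lebesgue {a..b} f"
proof -
  have "set_borel_measurable lebesgue {a..b} f"
    using assms(1) unfolding set_borel_measurable_def
    by (subst (asm) borel_measurable_restrict_space_iff) auto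
  moreover have "set_integrable lebesgue {a..b} (\<lambda>s. B)"
    unfolding set_integrable_def by (rule integrable_scaleR_left) (auto simp: integrable_indicator_iff emeasure_lborel_Icc_eq)
  moreover have "norm (f s) \<le> norm B" if "s \<in> {a..b}" for s
    using assms(2)[OF that] by simp
  ultimately show ?thesis
    by - (rule set_integrable_bound[where f = "\<lambda>_. B"], simp_all)
qed

lemma set_lebesgue_integral_norm_le:
  fixes f :: "real \<Rightarrow> 'b::{banach, second_countable_topology}" and g :: "real \<Rightarrow> real"
  assumes "set_integrable lebesgue A f" "set_integrable lebesgue A g"
    and "\<And>s. s \<in> A \<Longrightarrow> norm (f s) \<le> g s"
  shows "norm (LINT s:A|lebesgue. f s) \<le> (LINT s:A|lebesgue. g s)"
proof -
  have "norm (LINT s:A|lebesgue. f s) \<le> (LINT s|lebesgue. norm (indicat_real A s *\<^sub>R f s))"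
    unfolding set_lebesgue_integral_def by (rule integral_norm_bound)
  also have "\<dots> \<le> (LINT s:A|lebesgue. g s)"
    unfolding set_lebesgue_integral_def
  proof (rule integral_mono)
    show "integrable lebesgue (\<lambda>s. norm (indicat_real A s *\<^sub>R f s))"
      using assms(1) unfolding set_integrable_def by (rule integrable_norm)
    show "integrable lebesgue (\<lambda>s. indicat_real A s *\<^sub>R g s)"
      using assms(2) unfolding set_integrable_def .
  qed (use assms(3) in \<open>auto simp: indicator_def\<close>)
  finally show ?thesis .
qed

text \<open>The gain is the factor \<open>1 / l\<close>: when \<open>l\<close> is twice the
  Lipschitz constant, integration reproduces half of the weight at \<open>t\<close>. Both the
  Gronwall estimate and the contraction rest on this.\<close>

lemma set_lebesgue_integral_affine_exp_le:
  fixes a c l t :: real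
  assumes "0 \<le> t" "t \<le> T" "l > 0" "a \<ge> 0" "c \<ge> 0"
  shows "set_integrable lebesgue {0..t} (\<lambda>s. c + a * exp (l * s))"
    and "(LINT s:{0..t}|lebesgue. c + a * exp (l * s)) \<le> c * T + a * exp (l * t) / l"
proof -
  show int: "set_integrable lebesgue {0..t} (\<lambda>s. c + a * exp (l * s))"
  proof (rule set_integrable_bounded)
    show "(\<lambda>s. c + a * exp (l * s)) \<in> borel_measurable (lebesgue_on {0..t})"
      by (intro continuous_imp_measurable_on_sets_lebesgue continuous_intros) auto
    show "norm (c + a * exp (l * s)) \<le> c + a * exp (l * t)" if "s \<in> {0..t}" for s
      using that assms by (auto intro!: mult_left_mono)
  qed
  have "((\<lambda>s. c + a * exp (l * s)) has_integral
      (c * t + a * exp (l * t) / l) - (c * 0 + a * exp (l * 0) / l)) {0..t}"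
    using assms by (intro fundamental_theorem_of_calculus)
      (auto intro!: derivative_eq_intros simp flip: has_real_derivative_iff_has_vector_derivative)
  then have "(LINT s:{0..t}|lebesgue. c + a * exp (l * s)) = c * t + a * exp (l * t) / l - a / l"
    using set_lebesgue_integral_eq_integral(2)[OF int] by (simp add: integral_unique)
  also have "\<dots> \<le> c * T + a * exp (l * t) / l"
  proof -
    have "c * t \<le> c * T" "a / l \<ge> 0" using assms by (auto intro: mult_left_mono)
    then show ?thesis by linarith
  qed
  finally show "(LINT s:{0..t}|lebesgue. c + a * exp (l * s)) \<le> c * T + a * exp (l * t) / l" .
qed

text \<open>Proved by evaluating the hypothesis at a maximum of \<open>exp (- 2 L t) * \<phi> t\<close>, which costs
  a factor in the constants but needs no differentiation.\<close>

lemma Gronwall_weighted: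
  fixes \<phi> :: "real \<Rightarrow> real"
  assumes T: "T \<ge> 0" and cont: "continuous_on {0..T} \<phi>" and L: "L > 0" and ca: "a \<ge> 0" "c \<ge> 0"
    and nonneg: "\<And>t. t \<in> {0..T} \<Longrightarrow> \<phi> t \<ge> 0"
    and le: "\<And>t. t \<in> {0..T} \<Longrightarrow> \<phi> t \<le> a + (LINT s:{0..t}|lebesgue. c + L * \<phi> s)"
    and t: "t \<in> {0..T}"
  shows "\<phi> t \<le> 2 * (a + c * T) * exp (2 * L * T)"
proof -
  define w where "w s = exp (- (2 * L * s)) * \<phi> s" for s
  have "continuous_on {0..T} w" unfolding w_def by (intro continuous_intros cont)
  then obtain m where m: "m \<in> {0..T}" "\<And>s. s \<in> {0..T} \<Longrightarrow> w s \<le> w m"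
    using continuous_attains_sup[of "{0..T}" w] T by fastforce
  have \<phi>w: "\<phi> s = w s * exp (2 * L * s)" for s
    by (simp add: w_def exp_minus field_simps)
  have wm: "w m \<ge> 0" using nonneg[OF m(1)] by (simp add: w_def)
  have bd: "\<phi> s \<le> w m * exp (2 * L * s)" if "s \<in> {0..T}" for s
    using m(2)[OF that] by (simp add: \<phi>w[of s])
  have int: "set_integrable lebesgue {0..m} (\<lambda>s. c + L * \<phi> s)"
  proof (rule set_integrable_bounded)
    show "(\<lambda>s. c + L * \<phi> s) \<in> borel_measurable (lebesgue_on {0..m})"
      using m(1) by (intro continuous_imp_measurable_on_sets_lebesgue continuous_intros
          continuous_on_subset[OF cont]) auto
    show "norm (c + L * \<phi> s) \<le> c + L * (w m * exp (2 * L * T))" if "s \<in> {0..m}" for s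
    proof -
      have s: "s \<in> {0..T}" using that m by auto
      have "w m * exp (2 * L * s) \<le> w m * exp (2 * L * T)"
        using s L wm by (intro mult_left_mono) auto
      then have "L * \<phi> s \<le> L * (w m * exp (2 * L * T))" "0 \<le> L * \<phi> s"
        using bd[OF s] L nonneg[OF s] by (auto intro!: mult_left_mono)
      then show ?thesis using ca by simp
    qed
  qed
  note exp_int = set_lebesgue_integral_affine_exp_le[of m T "2 * L" "L * w m" c]
  have "\<phi> m \<le> a + (LINT s:{0..m}|lebesgue. c + L * \<phi> s)" by (rule le[OF m(1)])
  also have "(LINT s:{0..m}|lebesgue. c + L * \<phi> s)
      \<le> (LINT s:{0..m}|lebesgue. c + (L * w m) * exp (2 * L * s))"
  proof (rule set_integral_mono[OF int])
    show "set_integrable lebesgue {0..m} (\<lambda>s. c + (L * w m) * exp (2 * L * s))"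
      using exp_int m L ca wm by auto
    show "c + L * \<phi> s \<le> c + (L * w m) * exp (2 * L * s)" if "s \<in> {0..m}" for s
      using bd[of s] that m L by (auto simp: mult.assoc)
  qed
  also have "\<dots> \<le> c * T + L * w m * exp (2 * L * m) / (2 * L)"
    using exp_int m L ca wm by auto
  \<comment> \<open>The rate \<open>2 * L\<close> leaves half of \<open>\<phi> m\<close>, which is
    absorbed on the left and produces the leading factor 2.\<close>
  also have "L * w m * exp (2 * L * m) / (2 * L) = \<phi> m / 2"
    using L by (simp add: \<phi>w[of m])
  finally have "\<phi> m \<le> 2 * (a + c * T)" by simp
  moreover have "w m \<le> \<phi> m"
    using nonneg[OF m(1)] m(1) L by (simp add: w_def mult_left_le_one_le)
  ultimately have "w m \<le> 2 * (a + c * T)" by linarith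
  moreover have "exp (2 * L * t) \<le> exp (2 * L * T)" using t L by simp
  ultimately have "w m * exp (2 * L * t) \<le> 2 * (a + c * T) * exp (2 * L * T)"
    using wm by (intro mult_mono) auto
  then show ?thesis using bd[OF t] by linarith
qed

section \<open>Mild solutions of semilinear equations\<close>

locale semigroup_bound =
  fixes S :: "real \<Rightarrow> 'h::{real_inner, banach, second_countable_topology} \<Rightarrow> 'h" and T M :: real
  assumes semigroup: "C0_semigroup S" and T: "T \<ge> 0"
    and M: "M \<ge> 1" "\<And>t x. t \<in> {0..T} \<Longrightarrow> norm (S t x) \<le> M * norm x"
begin

lemma bounded_linear_S: "t \<ge> 0 \<Longrightarrow> bounded_linear (S t)"
  using semigroup by (simp add: C0_semigroup_def)

text \<open>Strong continuity makes \<open>s \<mapsto> S (t - s) z\<close> continuous for fixed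
  \<open>z\<close>, and each \<open>S (t - s)\<close> is continuous in \<open>z\<close>; the
  composition lemma applies without any continuity in operator norm.\<close>

lemma convolution_measurable:
  assumes g: "g \<in> borel_measurable (lebesgue_on {0..T})" and t: "t \<in> {0..T}"
  shows "(\<lambda>s. S (t - s) (g s)) \<in> borel_measurable (lebesgue_on {0..t})"
proof (rule caratheodory_measurable[where G = "\<lambda>s. S (t - s)"])
  have "continuous_on {0..t} (\<lambda>s. S (t - s) z)" for z
    by (rule continuous_on_compose2[OF C0_semigroup_continuous[OF semigroup, of t z]])
      (auto intro!: continuous_intros)
  then show "(\<lambda>s. S (t - s) z) \<in> borel_measurable (lebesgue_on {0..t})" for z
    by (intro continuous_imp_measurable_on_sets_lebesgue) auto
  show "continuous_on UNIV (S (t - s))" if "s \<in> space (lebesgue_on {0..t})" for s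
    using that by (intro linear_continuous_on bounded_linear_S) auto
  show "g \<in> borel_measurable (lebesgue_on {0..t})"
    using g t by (rule_tac measurable_restrict_mono) auto
qed

lemma convolution_integrable:
  assumes g: "g \<in> borel_measurable (lebesgue_on {0..T})"
    and B: "\<And>s. s \<in> {0..T} \<Longrightarrow> norm (g s) \<le> B" and t: "t \<in> {0..T}"
  shows "set_integrable lebesgue {0..t} (\<lambda>s. S (t - s) (g s))"
proof (rule set_integrable_bounded[OF convolution_measurable[OF g t]])
  fix s assume s: "s \<in> {0..t}"
  have "norm (S (t - s) (g s)) \<le> M * norm (g s)" using s t by (intro M(2)) auto
  also have "\<dots> \<le> M * B" using B[of s] s t M(1) by (intro mult_left_mono) auto
  finally show "norm (S (t - s) (g s)) \<le> M * B" .
qed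

text \<open>Extending the integrands by zero puts the varying intervals on one measure space, where
  dominated convergence applies.\<close>

lemma convolution_continuous:
  assumes g: "g \<in> borel_measurable (lebesgue_on {0..T})"
    and B: "\<And>s. s \<in> {0..T} \<Longrightarrow> norm (g s) \<le> B"
  shows "continuous_on {0..T} (\<lambda>t. LINT s:{0..t}|lebesgue. S (t - s) (g s))"
  unfolding continuous_on_sequentially o_def
proof (intro allI ballI impI, elim conjE)
  fix \<tau> :: "nat \<Rightarrow> real" and t
  assume t: "t \<in> {0..T}" and \<tau>T: "\<forall>n. \<tau> n \<in> {0..T}" and \<tau>: "\<tau> \<longlonglongrightarrow> t"
  define \<psi> where "\<psi> r s = indicat_real {0..r} s *\<^sub>R S (r - s) (g s)" for r s
  have meas: "\<psi> r \<in> borel_measurable lebesgue" if "r \<in> {0..T}" for r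
    using convolution_integrable[OF g B that] unfolding \<psi>_def set_integrable_def
    by (rule borel_measurable_integrable)
  show "(\<lambda>n. LINT s:{0..\<tau> n}|lebesgue. S (\<tau> n - s) (g s)) \<longlonglongrightarrow> (LINT s:{0..t}|lebesgue. S (t - s) (g s))"
    unfolding set_lebesgue_integral_def \<psi>_def[symmetric]
  proof (rule integral_dominated_convergence)
    show "\<psi> t \<in> borel_measurable lebesgue" "\<psi> (\<tau> n) \<in> borel_measurable lebesgue" for n
      using meas t \<tau>T by auto
    show "integrable lebesgue (\<lambda>s. indicat_real {0..T} s *\<^sub>R (M * B))"
      by (rule integrable_scaleR_left) (auto simp: integrable_indicator_iff emeasure_lborel_Icc_eq)
    show "AE s in lebesgue. norm (\<psi> (\<tau> n) s) \<le> indicat_real {0..T} s *\<^sub>R (M * B)" for n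
    proof (rule AE_I2)
      fix s
      show "norm (\<psi> (\<tau> n) s) \<le> indicat_real {0..T} s *\<^sub>R (M * B)"
      proof (cases "s \<in> {0..\<tau> n}")
        case True
        then have "s \<in> {0..T}" "\<tau> n - s \<in> {0..T}" using \<tau>T[rule_format, of n] by auto
        then have "norm (S (\<tau> n - s) (g s)) \<le> M * B"
          using M(2)[of "\<tau> n - s" "g s"] mult_left_mono[OF B[of s], of M] M(1) by linarith
        then show ?thesis using True \<open>s \<in> {0..T}\<close> by (simp add: \<psi>_def)
      next
        case False
        have "norm (g 0) \<le> B" using T by (intro B) simp
        then have "B \<ge> 0" by (rule order_trans[OF norm_ge_zero])
        then show ?thesis using False M(1) by (simp add: \<psi>_def)
      qed
    qed
    \<comment> \<open>At \<open>s = t\<close> the indicator of \<open>{0..\<tau> n}\<close> may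
      oscillate, so this one point is discarded.\<close>
    have "AE s in lebesgue. s \<noteq> t"
      by (rule AE_completion) (rule AE_lborel_singleton)
    then show "AE s in lebesgue. (\<lambda>n. \<psi> (\<tau> n) s) \<longlonglongrightarrow> \<psi> t s"
    proof (rule AE_mp, intro AE_I2 impI)
      fix s assume "s \<noteq> t"
      show "(\<lambda>n. \<psi> (\<tau> n) s) \<longlonglongrightarrow> \<psi> t s"
      proof (cases "s < t \<and> 0 \<le> s")
        case True
        then have ev: "\<forall>\<^sub>F n in sequentially. s < \<tau> n" using order_tendstoD(1)[OF \<tau>] by blast
        \<comment> \<open>The truncation keeps the argument in \<open>{0..T}\<close> also for the
          finitely many \<open>n\<close> with \<open>\<tau> n < s\<close>.\<close>
        have "(\<lambda>n. S (max 0 (\<tau> n - s)) (g s)) \<longlonglongrightarrow> S (max 0 (t - s)) (g s)"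
        proof (rule continuous_on_tendsto_compose[OF C0_semigroup_continuous[OF semigroup, of T "g s"]])
          show "(\<lambda>n. max 0 (\<tau> n - s)) \<longlonglongrightarrow> max 0 (t - s)" using \<tau> by (intro tendsto_intros)
          show "\<forall>\<^sub>F n in sequentially. max 0 (\<tau> n - s) \<in> {0..T}"
          proof (intro always_eventually allI)
            show "max 0 (\<tau> n - s) \<in> {0..T}" for n
              using \<tau>T[rule_format, of n] True T by auto
          qed
          show "max 0 (t - s) \<in> {0..T}" using t True by auto
        qed
        moreover have "\<forall>\<^sub>F n in sequentially. S (max 0 (\<tau> n - s)) (g s) = \<psi> (\<tau> n) s"
          using ev by eventually_elim (use True in \<open>auto simp: \<psi>_def\<close>)
        moreover have "S (max 0 (t - s)) (g s) = \<psi> t s" using True by (simp add: \<psi>_def)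
        ultimately show ?thesis by (simp add: tendsto_cong)
      next
        case False
        have "\<forall>\<^sub>F n in sequentially. \<psi> (\<tau> n) s = 0"
        proof (cases "0 \<le> s")
          case True
          then have "t < s" using False \<open>s \<noteq> t\<close> by auto
          then have "\<forall>\<^sub>F n in sequentially. \<tau> n < s" using order_tendstoD(2)[OF \<tau>] by blast
          then show ?thesis by eventually_elim (simp add: \<psi>_def)
        qed (simp add: \<psi>_def)
        moreover have "\<psi> t s = 0" using False \<open>s \<noteq> t\<close> by (auto simp: \<psi>_def)
        ultimately show ?thesis by (simp add: tendsto_eventually)
      qed
    qed
  qed
qed

lemma convolution_diff_le:
  assumes g1: "g1 \<in> borel_measurable (lebesgue_on {0..T})" "\<And>s. s \<in> {0..T} \<Longrightarrow> norm (g1 s) \<le> B1"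
    and g2: "g2 \<in> borel_measurable (lebesgue_on {0..T})" "\<And>s. s \<in> {0..T} \<Longrightarrow> norm (g2 s) \<le> B2"
    and t: "t \<in> {0..T}"
    and \<phi>: "set_integrable lebesgue {0..t} \<phi>"
    and le: "\<And>s. s \<in> {0..t} \<Longrightarrow> M * norm (g1 s - g2 s) \<le> \<phi> s"
  shows "norm ((LINT s:{0..t}|lebesgue. S (t - s) (g1 s)) - (LINT s:{0..t}|lebesgue. S (t - s) (g2 s)))
    \<le> (LINT s:{0..t}|lebesgue. \<phi> s)"
proof -
  have int: "set_integrable lebesgue {0..t} (\<lambda>s. S (t - s) (g1 s))"
    "set_integrable lebesgue {0..t} (\<lambda>s. S (t - s) (g2 s))"
    by (rule convolution_integrable; fact)+
  have "norm (LINT s:{0..t}|lebesgue. S (t - s) (g1 s) - S (t - s) (g2 s)) \<le> (LINT s:{0..t}|lebesgue. \<phi> s)"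
  proof (rule set_lebesgue_integral_norm_le[OF set_integral_diff(1)[OF int] \<phi>])
    fix s assume s: "s \<in> {0..t}"
    then have "S (t - s) (g1 s) - S (t - s) (g2 s) = S (t - s) (g1 s - g2 s)"
      using linear_diff[OF bounded_linear.linear[OF bounded_linear_S[of "t - s"]]] by simp
    then have "norm (S (t - s) (g1 s) - S (t - s) (g2 s)) \<le> M * norm (g1 s - g2 s)"
      using M(2)[of "t - s"] s t by simp
    then show "norm (S (t - s) (g1 s) - S (t - s) (g2 s)) \<le> \<phi> s"
      using le[OF s] by linarith
  qed
  then show ?thesis by (simp add: set_integral_diff(2)[OF int])
qed

text \<open>Measurability and boundedness are assumed only along continuous curves, because the
  right-hand side will contain \<open>U\<close>, whose dependence on time is controlled along such
  curves.\<close>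

lemma mild_fixed_point:
  fixes G :: "real \<Rightarrow> 'h \<Rightarrow> 'h"
  assumes meas: "\<And>x. continuous_on {0..T} x \<Longrightarrow> (\<lambda>s. G s (x s)) \<in> borel_measurable (lebesgue_on {0..T})"
    and bdd: "\<And>x. continuous_on {0..T} x \<Longrightarrow> \<exists>B. \<forall>s\<in>{0..T}. norm (G s (x s)) \<le> B"
    and lip: "\<And>s x y. s \<in> {0..T} \<Longrightarrow> norm (G s x - G s y) \<le> L * norm (x - y)" and L: "L > 0"
  obtains x where "continuous_on {0..T} x"
    "\<And>t. t \<in> {0..T} \<Longrightarrow> x t = S t \<zeta> + (LINT s:{0..t}|lebesgue. S (t - s) (G s (x s)))"
proof -
  \<comment> \<open>Twice the Lipschitz constant of the integrand, so that the weighted integral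
    operator contracts by \<open>1 / 2\<close>.\<close>
  define l where "l = 2 * (M * L)"
  have l: "l > 0" using M(1) L by (simp add: l_def)
  \<comment> \<open>The unknown is \<open>z s = exp (- l s) x s\<close> in the complete space of
    bounded continuous functions on the whole line; \<open>X z\<close> removes the weight.\<close>
  define X where "X z s = exp (l * s) *\<^sub>R apply_bcontfun z s" for z :: "real \<Rightarrow>\<^sub>C 'h" and s
  have X: "continuous_on {0..T} (X z)" for z
    unfolding X_def by (intro continuous_intros) auto
  obtain B where B: "\<And>z s. s \<in> {0..T} \<Longrightarrow> norm (G s (X z s)) \<le> B z"
    using bdd[OF X] by metis
  define \<Phi> where "\<Phi> z t = S t \<zeta> + (LINT s:{0..t}|lebesgue. S (t - s) (G s (X z s)))" for z t
  have \<Phi>: "continuous_on {0..T} (\<Phi> z)" for z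
    unfolding \<Phi>_def
    by (intro continuous_on_add C0_semigroup_continuous semigroup convolution_continuous[OF meas[OF X] B])
  \<comment> \<open>Clamping extends a function on \<open>{0..T}\<close> by its endpoint values. The
    first clause serves the fixed point equation, the second the supremum over the line.\<close>
  have "\<exists>g :: real \<Rightarrow>\<^sub>C 'h. (\<forall>t\<in>{0..T}. g t = exp (- (l * t)) *\<^sub>R \<Phi> z t)
      \<and> (\<forall>t. g t = exp (- (l * clamp 0 T t)) *\<^sub>R \<Phi> z (clamp 0 T t))" for z
  proof -
    have "continuous_on (cbox 0 T) (\<lambda>t. exp (- (l * t)) *\<^sub>R \<Phi> z t)"
      using \<Phi> by (auto intro!: continuous_intros)
    then show ?thesis by (rule continuous_on_cbox_bcontfunE) (auto intro!: exI)
  qed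
  then obtain F :: "(real \<Rightarrow>\<^sub>C 'h) \<Rightarrow> (real \<Rightarrow>\<^sub>C 'h)"
    where F: "\<And>z t. t \<in> {0..T} \<Longrightarrow> F z t = exp (- (l * t)) *\<^sub>R \<Phi> z t"
      and Fc: "\<And>z t. F z t = exp (- (l * clamp 0 T t)) *\<^sub>R \<Phi> z (clamp 0 T t)"
    by metis
  have diff: "norm (\<Phi> z t - \<Phi> w t) \<le> exp (l * t) * (dist z w / 2)" if t: "t \<in> {0..T}" for z w t
  proof -
    note ex = set_lebesgue_integral_affine_exp_le[of t T l "M * L * dist z w" 0]
    have "norm (\<Phi> z t - \<Phi> w t) \<le> (LINT s:{0..t}|lebesgue. 0 + M * L * dist z w * exp (l * s))"
      unfolding \<Phi>_def add_diff_cancel_left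
    proof (rule convolution_diff_le[OF meas[OF X] B meas[OF X] B t])
      show "set_integrable lebesgue {0..t} (\<lambda>s. 0 + M * L * dist z w * exp (l * s))"
        using ex t l M(1) L by auto
      fix s assume s: "s \<in> {0..t}"
      have "norm (X z s - X w s) = exp (l * s) * dist (z s) (w s)"
        by (simp add: X_def dist_norm flip: scaleR_diff_right)
      also have "\<dots> \<le> exp (l * s) * dist z w" by (intro mult_left_mono dist_bounded) auto
      finally have "L * norm (X z s - X w s) \<le> L * (exp (l * s) * dist z w)"
        using L by (intro mult_left_mono) auto
      then have "norm (G s (X z s) - G s (X w s)) \<le> L * (exp (l * s) * dist z w)"
        using lip[of s "X z s" "X w s"] s t by auto
      then have "M * norm (G s (X z s) - G s (X w s)) \<le> M * (L * (exp (l * s) * dist z w))"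
        using M(1) by (intro mult_left_mono) auto
      then show "M * norm (G s (X z s) - G s (X w s)) \<le> 0 + M * L * dist z w * exp (l * s)"
        by (simp add: mult_ac)
    qed
    also have "\<dots> \<le> 0 * T + M * L * dist z w * exp (l * t) / l"
      using ex t l M(1) L by auto
    also have "\<dots> = exp (l * t) * (dist z w / 2)" using M(1) L by (simp add: l_def)
    finally show ?thesis .
  qed
  have "dist (F z) (F w) \<le> (1 / 2) * dist z w" for z w
  proof (rule dist_bound)
    fix r
    define t where "t = clamp 0 T r"
    have t: "t \<in> {0..T}" using clamp_in_interval[of 0 T r] T by (simp add: t_def)
    have "dist (F z r) (F w r) = exp (- (l * t)) * norm (\<Phi> z t - \<Phi> w t)"
      by (simp add: Fc t_def dist_norm flip: scaleR_diff_right)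
    also have "\<dots> \<le> exp (- (l * t)) * (exp (l * t) * (dist z w / 2))"
      by (intro mult_left_mono diff t) auto
    also have "\<dots> = (1 / 2) * dist z w" by (simp add: exp_minus)
    finally show "dist (F z r) (F w r) \<le> (1 / 2) * dist z w" .
  qed
  then obtain z where z: "F z = z"
    using banach_fix_type[of "1 / 2" F] by auto
  show thesis
  proof
    show "continuous_on {0..T} (X z)" by (rule X)
    fix t assume t: "t \<in> {0..T}"
    have "X z t = \<Phi> z t" using F[OF t, of z] by (simp add: X_def z exp_minus)
    then show "X z t = S t \<zeta> + (LINT s:{0..t}|lebesgue. S (t - s) (G s (X z s)))"
      by (simp add: \<Phi>_def)
  qed
qed

end

section \<open>The coupled problem\<close>

text \<open>A modulus need not vanish at 0 itself; the punctured filter keeps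
  \<open>\<bar>t - t0\<bar>\<close> positive.\<close>

lemma modulus_tendsto_abs_diff:
  fixes t0 :: real
  assumes "modulus g"
  shows "((\<lambda>t. g \<bar>t - t0\<bar>) \<longlongrightarrow> 0) (at t0 within A)"
proof -
  have "((\<lambda>t. \<bar>t - t0\<bar>) \<longlongrightarrow> \<bar>t0 - t0\<bar>) (at t0 within A)" by (intro tendsto_intros)
  moreover have "\<forall>\<^sub>F t in at t0 within A. \<bar>t - t0\<bar> \<in> {0<..} \<and> \<bar>t - t0\<bar> \<noteq> 0"
    by (auto simp: eventually_at_filter)
  ultimately have "filterlim (\<lambda>t. \<bar>t - t0\<bar>) (at_right 0) (at t0 within A)"
    by (simp add: filterlim_at)
  moreover have "(g \<longlongrightarrow> 0) (at_right 0)" using assms by (simp add: modulus_def)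
  ultimately show ?thesis by (rule filterlim_compose[rotated])
qed

text \<open>The set where \<open>v\<close> is nonzero inside the interval is open and null, hence
  empty; the endpoints follow by closure.\<close>

lemma continuous_AE_zero_imp_zero:
  fixes v :: "real \<Rightarrow> 'b::real_normed_vector"
  assumes ab: "a < b" and cont: "continuous_on {a..b} v"
    and AE: "AE t in lebesgue_on {a<..<b}. v t = 0" and t: "t \<in> {a..b}"
  shows "v t = 0"
proof -
  define N where "N = {t \<in> {a<..<b}. v t \<noteq> 0}"
  have "open N"
  proof -
    have "open ({a<..<b} \<inter> v -` (- {0}))"
      by (rule continuous_open_preimage[OF continuous_on_subset[OF cont]]) auto
    moreover have "N = {a<..<b} \<inter> v -` (- {0})" by (auto simp: N_def)
    ultimately show ?thesis by simp
  qed
  have "AE t in lebesgue. t \<notin> N"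
    using AE by (subst (asm) AE_restrict_space_iff) (auto simp: N_def)
  then have "negligible N"
    using \<open>open N\<close> by (simp add: negligible_iff_null_sets AE_iff_null_sets)
  then have "N = {}" using open_not_negligible \<open>open N\<close> by blast
  then have "\<forall>s\<in>{a<..<b}. v s = 0" by (auto simp: N_def)
  then show ?thesis
    using continuous_constant_on_closure[of "{a<..<b}" v 0 t] cont t ab
    by (simp add: closure_greaterThanLessThan)
qed

lemma continuous_on_Icc_bounded:
  fixes x :: "real \<Rightarrow> 'b::real_normed_vector"
  assumes "continuous_on {a..b} x"
  obtains B where "\<And>s. s \<in> {a..b} \<Longrightarrow> norm (x s) \<le> B"
  using compact_imp_bounded[OF compact_continuous_image[OF assms compact_Icc]]
  unfolding bounded_iff by blast

locale evolution_VI =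
  fixes T :: real
    and A :: "('h::{real_inner, banach, second_countable_topology} \<times> 'h) set"
    and expA :: "real \<Rightarrow> 'h \<Rightarrow> 'h"
    and P :: "'h \<Rightarrow> 'h"
    and K :: "real \<Rightarrow> 'h set"
    and f h :: "real \<Rightarrow> 'h \<Rightarrow> 'h \<Rightarrow> 'e::metric_space \<Rightarrow> 'h"
  assumes T: "T > 0"
    and standing: "standing_assumption T A expA P K f h"
    and set_reg: "set_regularity T K"
    and data: "parameterized_data T P K f h"
begin

section \<open>The individual hypotheses on the semigroup, the sets and the data\<close>

lemma semigroup: "C0_semigroup expA"
  using standing unfolding standing_assumption_def generates_def by blast

lemma K: "t \<in> {0..T} \<Longrightarrow> convex (K t)" "t \<in> {0..T} \<Longrightarrow> closed (K t)" "t \<in> {0..T} \<Longrightarrow> K t \<noteq> {}"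
  using standing unfolding standing_assumption_def by blast+

lemma P_inverse:
  obtains c where "c > 0" "\<And>y. P (inv P y) = y" "\<And>x. inv P (P x) = x"
    "\<And>y1 y2. norm (inv P y1 - inv P y2) \<le> norm (y1 - y2) / c"
proof -
  have "bounded_linear P" "coercive P" using standing unfolding standing_assumption_def by blast+
  then show thesis using that coercive_bij by blast
qed

lemma P_inv [simp]: "P (inv P y) = y" "inv P (P x) = x"
  by (rule P_inverse, blast)+

lemma Lipschitz_data:
  assumes "bounded D"
  obtains \<alpha>f \<beta>f \<alpha>h where "\<alpha>f \<ge> 0" "\<beta>f \<ge> 0" "\<alpha>h \<ge> 0"
    "\<And>t \<eta> x1 x2 u1 u2. t \<in> {0..T} \<Longrightarrow> \<eta> \<in> D \<Longrightarrow>
      norm (f t x1 u1 \<eta> - f t x2 u2 \<eta>) \<le> \<alpha>f * norm (x1 - x2) + \<beta>f * norm (u1 - u2)"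
    "\<And>t \<eta> x1 x2 u. t \<in> {0..T} \<Longrightarrow> \<eta> \<in> D \<Longrightarrow> norm (h t x1 u \<eta> - h t x2 u \<eta>) \<le> \<alpha>h * norm (x1 - x2)"
proof -
  have "\<exists>\<alpha>f \<beta>f \<alpha>h. \<alpha>f \<ge> 0 \<and> \<beta>f \<ge> 0 \<and> \<alpha>h \<ge> 0 \<and>
        (\<forall>t\<in>{0..T}. \<forall>\<eta>\<in>D. \<forall>x1 x2 u1 u2 u.
           norm (f t x1 u1 \<eta> - f t x2 u2 \<eta>) \<le> \<alpha>f * norm (x1 - x2) + \<beta>f * norm (u1 - u2) \<and>
           norm (h t x1 u \<eta> - h t x2 u \<eta>) \<le> \<alpha>h * norm (x1 - x2))"
    by (rule data[unfolded parameterized_data_def, THEN conjunct2, THEN conjunct1, THEN spec, THEN mp, OF assms])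
  then show thesis using that by blast
qed

lemma parameter_moduli:
  assumes "bounded D" "R \<ge> 0"
  obtains \<gamma>f \<gamma>h where "modulus \<gamma>f" "modulus \<gamma>h"
    "\<And>t \<eta>1 \<eta>2 x u. t \<in> {0..T} \<Longrightarrow> \<eta>1 \<in> D \<Longrightarrow> \<eta>2 \<in> D \<Longrightarrow> norm x \<le> R \<Longrightarrow> norm u \<le> R \<Longrightarrow>
      norm (f t x u \<eta>1 - f t x u \<eta>2) \<le> \<gamma>f (dist \<eta>1 \<eta>2) \<and>
      norm (h t x u \<eta>1 - h t x u \<eta>2) \<le> \<gamma>h (dist \<eta>1 \<eta>2)"
proof -
  have "\<exists>\<gamma>f \<gamma>h. modulus \<gamma>f \<and> modulus \<gamma>h \<and>
        (\<forall>t\<in>{0..T}. \<forall>\<eta>1\<in>D. \<forall>\<eta>2\<in>D. \<forall>x\<in>cball 0 R. \<forall>u\<in>cball 0 R.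
           norm (f t x u \<eta>1 - f t x u \<eta>2) \<le> \<gamma>f (dist \<eta>1 \<eta>2) \<and>
           norm (h t x u \<eta>1 - h t x u \<eta>2) \<le> \<gamma>h (dist \<eta>1 \<eta>2))"
    by (rule data[unfolded parameterized_data_def, THEN conjunct2, THEN conjunct2, THEN conjunct1, THEN spec, THEN mp, THEN spec, THEN mp, OF assms])
  then obtain \<gamma>f \<gamma>h where \<gamma>: "modulus \<gamma>f" "modulus \<gamma>h"
    and le: "\<forall>t\<in>{0..T}. \<forall>\<eta>1\<in>D. \<forall>\<eta>2\<in>D. \<forall>x\<in>cball 0 R. \<forall>u\<in>cball 0 R.
           norm (f t x u \<eta>1 - f t x u \<eta>2) \<le> \<gamma>f (dist \<eta>1 \<eta>2) \<and>
           norm (h t x u \<eta>1 - h t x u \<eta>2) \<le> \<gamma>h (dist \<eta>1 \<eta>2)"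
    by (elim exE conjE)
  show thesis
    by (rule that[OF \<gamma>]) (use le[unfolded Ball_def mem_cball_0] in blast)
qed

lemma time_modulus_h:
  assumes "R \<ge> 0"
  obtains \<omega> where "modulus \<omega>"
    "\<And>t1 t2 x u. t1 \<in> {0..T} \<Longrightarrow> t2 \<in> {0..T} \<Longrightarrow> norm x \<le> R \<Longrightarrow> norm u \<le> R \<Longrightarrow>
      norm (h t1 x u \<eta> - h t2 x u \<eta>) \<le> \<omega> \<bar>t1 - t2\<bar>"
proof -
  have "bounded {\<eta>}" by simp
  have "\<exists>\<omega>. modulus \<omega> \<and>
        (\<forall>t1\<in>{0..T}. \<forall>t2\<in>{0..T}. \<forall>\<eta>\<in>{\<eta>}. \<forall>x\<in>cball 0 R. \<forall>u\<in>cball 0 R.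
           norm (h t1 x u \<eta> - h t2 x u \<eta>) \<le> \<omega> \<bar>t1 - t2\<bar>)"
    by (rule data[unfolded parameterized_data_def, THEN conjunct2, THEN conjunct2, THEN conjunct2, THEN conjunct1, THEN spec, THEN mp, THEN spec, THEN mp, OF \<open>bounded {\<eta>}\<close> assms])
  then obtain \<omega> where \<omega>: "modulus \<omega>"
    and le: "\<forall>t1\<in>{0..T}. \<forall>t2\<in>{0..T}. \<forall>\<eta>\<in>{\<eta>}. \<forall>x\<in>cball 0 R. \<forall>u\<in>cball 0 R.
           norm (h t1 x u \<eta> - h t2 x u \<eta>) \<le> \<omega> \<bar>t1 - t2\<bar>"
    by (elim exE conjE)
  show thesis
    by (rule that[OF \<omega>]) (use le[unfolded Ball_def mem_cball_0] in blast)
qed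

lemma F_op_regular:
  assumes "bounded D"
  obtains \<gamma> L where "\<gamma> > 0" "L > 0"
    "\<And>\<eta> t x. \<eta> \<in> D \<Longrightarrow> t \<in> {0..T} \<Longrightarrow> strongly_pseudomonotone_on \<gamma> (K t) (F_op P h \<eta> t x)"
    "\<And>\<eta> t x. \<eta> \<in> D \<Longrightarrow> t \<in> {0..T} \<Longrightarrow> L-lipschitz_on UNIV (F_op P h \<eta> t x)"
proof -
  have "\<exists>\<gamma> L. \<gamma> > 0 \<and> L > 0 \<and>
        (\<forall>\<eta>\<in>D. \<forall>t\<in>{0..T}. \<forall>x.
           strongly_pseudomonotone_on \<gamma> (K t) (F_op P h \<eta> t x) \<and>
           L-lipschitz_on UNIV (F_op P h \<eta> t x))"
    by (rule data[unfolded parameterized_data_def, THEN conjunct2, THEN conjunct2, THEN conjunct2, THEN conjunct2, THEN conjunct1, THEN spec, THEN mp, OF assms])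
  then show thesis using that by blast
qed

lemma f_origin_bounded:
  obtains C where "\<And>t. t \<in> {0..T} \<Longrightarrow> norm (f t 0 0 \<eta>) \<le> C"
proof -
  have "bounded {\<eta>}" by simp
  have "\<exists>C\<ge>0. \<forall>\<eta>\<in>{\<eta>}. \<forall>t\<in>{0..T}. norm (f t 0 0 \<eta>) \<le> C"
    by (rule data[unfolded parameterized_data_def, THEN conjunct2, THEN conjunct2, THEN conjunct2, THEN conjunct2, THEN conjunct2, THEN conjunct2, THEN spec, THEN mp, OF \<open>bounded {\<eta>}\<close>])
  then show thesis using that by blast
qed

text \<open>The control at state \<open>x\<close>, recovered from the solution \<open>y = P u\<close> of the variational
  inequality on \<open>K t\<close>.\<close>

definition U :: "'e \<Rightarrow> real \<Rightarrow> 'h \<Rightarrow> 'h" where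
  "U \<eta> t x = inv P (SOME y. solves_VI (K t) (F_op P h \<eta> t x) y)"

section \<open>The control as a function of parameter, time and state\<close>

lemma U_solves:
  assumes t: "t \<in> {0..T}"
  shows "solves_VI (K t) (F_op P h \<eta> t x) (P (U \<eta> t x))"
proof -
  have "bounded {\<eta>}" by simp
  then obtain \<gamma> L where "strongly_pseudomonotone_on \<gamma> (K t) (F_op P h \<eta> t x)"
    "L-lipschitz_on UNIV (F_op P h \<eta> t x)"
    using F_op_regular t by (metis singletonI)
  then obtain y where "solves_VI (K t) (F_op P h \<eta> t x) y"
    using strongly_pseudomonotone_VI_exists[OF K[OF t]] lipschitz_on_continuous_on continuous_on_subset subset_UNIV
    by metis
  then show ?thesis by (simp add: U_def someI)
qed

text \<open>The constant depends on \<open>D\<close> only, and the change of parameter is measured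
  at the second solution.\<close>

lemma U_stability:
  assumes "bounded D"
  obtains c where "c \<ge> 0"
    "\<And>t \<eta>1 \<eta>2 x1 x2 u1 u2. t \<in> {0..T} \<Longrightarrow> \<eta>1 \<in> D \<Longrightarrow> \<eta>2 \<in> D \<Longrightarrow>
      solves_VI (K t) (F_op P h \<eta>1 t x1) (P u1) \<Longrightarrow> solves_VI (K t) (F_op P h \<eta>2 t x2) (P u2) \<Longrightarrow>
      norm (u1 - u2) \<le> c * (norm (x1 - x2) + norm (h t x2 u2 \<eta>1 - h t x2 u2 \<eta>2))"
proof -
  obtain \<gamma> L where \<gamma>: "\<gamma> > 0"
    "\<And>\<eta> t x. \<eta> \<in> D \<Longrightarrow> t \<in> {0..T} \<Longrightarrow> strongly_pseudomonotone_on \<gamma> (K t) (F_op P h \<eta> t x)"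
    using F_op_regular[OF assms] by metis
  obtain \<alpha>h where \<alpha>: "\<alpha>h \<ge> 0"
    "\<And>t \<eta> x1 x2 u. t \<in> {0..T} \<Longrightarrow> \<eta> \<in> D \<Longrightarrow> norm (h t x1 u \<eta> - h t x2 u \<eta>) \<le> \<alpha>h * norm (x1 - x2)"
    using Lipschitz_data[OF assms] by metis
  obtain c where c: "c > 0" "\<And>y1 y2. norm (inv P y1 - inv P y2) \<le> norm (y1 - y2) / c"
    by (rule P_inverse) blast
  show thesis
  proof
    \<comment> \<open>\<open>\<alpha>h\<close> accounts for the change of state and 1 for the change
      of parameter; \<open>\<gamma>\<close> comes from the variational inequality and
      \<open>c\<close> from inverting \<open>P\<close>.\<close>
    show "(\<alpha>h + 1) / \<gamma> / c \<ge> 0" using \<alpha>(1) \<gamma>(1) c(1) by simp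
    fix t \<eta>1 \<eta>2 x1 x2 u1 u2
    assume t: "t \<in> {0..T}" and \<eta>: "\<eta>1 \<in> D" "\<eta>2 \<in> D"
      and sol: "solves_VI (K t) (F_op P h \<eta>1 t x1) (P u1)" "solves_VI (K t) (F_op P h \<eta>2 t x2) (P u2)"
    let ?e = "norm (h t x2 u2 \<eta>1 - h t x2 u2 \<eta>2)"
    have "F_op P h \<eta>1 t x1 (P u2) - F_op P h \<eta>2 t x2 (P u2)
        = - ((h t x1 u2 \<eta>1 - h t x2 u2 \<eta>1) + (h t x2 u2 \<eta>1 - h t x2 u2 \<eta>2))"
      by (simp add: F_op_def)
    then have "norm (F_op P h \<eta>1 t x1 (P u2) - F_op P h \<eta>2 t x2 (P u2))
        \<le> norm (h t x1 u2 \<eta>1 - h t x2 u2 \<eta>1) + ?e"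
      by (simp only: norm_minus_cancel norm_triangle_ineq)
    also have "\<dots> \<le> \<alpha>h * norm (x1 - x2) + ?e" using \<alpha>(2)[OF t \<eta>(1)] by simp
    also have "\<dots> \<le> (\<alpha>h + 1) * (norm (x1 - x2) + ?e)"
      using \<alpha>(1) by (simp add: algebra_simps)
    finally have d: "norm (F_op P h \<eta>1 t x1 (P u2) - F_op P h \<eta>2 t x2 (P u2)) \<le> \<dots>" .
    have "norm (u1 - u2) \<le> norm (P u1 - P u2) / c" using c(2)[of "P u1" "P u2"] by simp
    also have "norm (P u1 - P u2) \<le> norm (F_op P h \<eta>1 t x1 (P u2) - F_op P h \<eta>2 t x2 (P u2)) / \<gamma>"
      by (rule strongly_pseudomonotone_VI_stability[OF \<gamma>(2)[OF \<eta>(1) t] sol])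
    also have "\<dots> \<le> (\<alpha>h + 1) * (norm (x1 - x2) + ?e) / \<gamma>"
      using d \<gamma>(1) by (intro divide_right_mono) auto
    finally show "norm (u1 - u2) \<le> (\<alpha>h + 1) / \<gamma> / c * (norm (x1 - x2) + ?e)"
      using c(1) by (simp add: divide_right_mono)
  qed
qed

text \<open>Since \<open>F_op P h \<eta> t x (P u) = u - h t x u \<eta>\<close>, membership in the
  normal cone is the variational inequality for \<open>P u\<close>, whose solution is unique by the
  stability estimate with equal operators.\<close>

lemma inclusion_iff_U:
  assumes t: "t \<in> {0..T}"
  shows "u \<in> (\<lambda>\<xi>. h t x u \<eta> - \<xi>) ` normal_cone (K t) (P u) \<longleftrightarrow> u = U \<eta> t x"
proof -
  have "u \<in> (\<lambda>\<xi>. h t x u \<eta> - \<xi>) ` normal_cone (K t) (P u) \<longleftrightarrow> h t x u \<eta> - u \<in> normal_cone (K t) (P u)"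
  proof -
    have "w \<in> (\<lambda>\<xi>. v - \<xi>) ` N \<longleftrightarrow> v - w \<in> N" for v w :: 'h and N
      by (force simp: image_iff intro: bexI[of _ "v - w"])
    then show ?thesis .
  qed
  also have "\<dots> \<longleftrightarrow> solves_VI (K t) (F_op P h \<eta> t x) (P u)"
    by (auto simp: normal_cone_def solves_VI_def F_op_def inner_diff_left)
  also have "\<dots> \<longleftrightarrow> u = U \<eta> t x"
  proof
    assume sol: "solves_VI (K t) (F_op P h \<eta> t x) (P u)"
    obtain \<gamma> L where "strongly_pseudomonotone_on \<gamma> (K t) (F_op P h \<eta> t x)"
      using F_op_regular[of "{\<eta>}"] t by (metis bounded_insert bounded_empty singletonI)
    from strongly_pseudomonotone_VI_stability[OF this sol U_solves[OF t, of \<eta> x]]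
    have "P u = P (U \<eta> t x)" by simp
    then show "u = U \<eta> t x" by (metis P_inv(2))
  qed (use U_solves[OF t] in simp)
  finally show ?thesis .
qed

text \<open>Everything is compared with the solution at the fixed time \<open>t0\<close>; the bound
  \<open>\<rho>\<close> adds the motion of the set, the change of state and the explicit time
  dependence of \<open>h\<close>.\<close>

lemma U_continuous:
  assumes x: "continuous_on {0..T} x"
  shows "continuous_on {0..T} (\<lambda>t. U \<eta> t (x t))"
  unfolding continuous_on_def
proof
  fix t0 assume t0: "t0 \<in> {0..T}"
  have "bounded {\<eta>}" by simp
  then obtain \<gamma> L where F: "\<gamma> > 0" "L > 0"
    "\<And>t x. t \<in> {0..T} \<Longrightarrow> strongly_pseudomonotone_on \<gamma> (K t) (F_op P h \<eta> t x)"
    "\<And>t x. t \<in> {0..T} \<Longrightarrow> L-lipschitz_on UNIV (F_op P h \<eta> t x)"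
    using F_op_regular by (metis singletonI)
  obtain \<alpha>h where \<alpha>: "\<alpha>h \<ge> 0"
    "\<And>t x1 x2 u. t \<in> {0..T} \<Longrightarrow> norm (h t x1 u \<eta> - h t x2 u \<eta>) \<le> \<alpha>h * norm (x1 - x2)"
    using Lipschitz_data[OF \<open>bounded {\<eta>}\<close>] by (metis singletonI)
  obtain c where c: "c > 0" "\<And>y1 y2. norm (inv P y1 - inv P y2) \<le> norm (y1 - y2) / c"
    by (rule P_inverse) blast
  define u0 where "u0 = U \<eta> t0 (x t0)"
  define F0 where "F0 = F_op P h \<eta> t0 (x t0)"
  \<comment> \<open>This vector does not depend on \<open>t\<close>, and its projection onto
    \<open>K t0\<close> is \<open>P u0\<close>; set regularity with radius \<open>norm z\<close>
    therefore bounds the comparison point.\<close>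
  define z where "z = P u0 - F0 (P u0)"
  have proj0: "metric_proj (K t0) z = P u0"
    unfolding z_def F0_def u0_def by (rule solves_VI_metric_proj[OF K(1,2)[OF t0] U_solves[OF t0]])
  obtain \<omega>K where \<omega>K: "modulus \<omega>K"
    "\<And>t. t \<in> {0..T} \<Longrightarrow> norm (metric_proj (K t) z - P u0) \<le> \<omega>K \<bar>t - t0\<bar>"
  proof -
    obtain \<omega> where "modulus \<omega>" "\<And>t1 t2. t1 \<in> {0..T} \<Longrightarrow> t2 \<in> {0..T} \<Longrightarrow>
        norm (metric_proj (K t1) z - metric_proj (K t2) z) \<le> \<omega> \<bar>t1 - t2\<bar>"
      using set_reg[unfolded set_regularity_def, rule_format, of "norm z"] by auto
    from this(1) this(2)[OF _ t0] show thesis using that proj0 by metis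
  qed
  obtain \<omega>h where \<omega>h: "modulus \<omega>h"
    "\<And>t. t \<in> {0..T} \<Longrightarrow> norm (h t (x t0) u0 \<eta> - h t0 (x t0) u0 \<eta>) \<le> \<omega>h \<bar>t - t0\<bar>"
  proof -
    obtain \<omega> where "modulus \<omega>" "\<And>t1 t2 x' u. t1 \<in> {0..T} \<Longrightarrow> t2 \<in> {0..T} \<Longrightarrow>
        norm x' \<le> max (norm (x t0)) (norm u0) \<Longrightarrow> norm u \<le> max (norm (x t0)) (norm u0) \<Longrightarrow>
        norm (h t1 x' u \<eta> - h t2 x' u \<eta>) \<le> \<omega> \<bar>t1 - t2\<bar>"
      by (rule time_modulus_h[of "max (norm (x t0)) (norm u0)" \<eta>]) (auto simp: le_max_iff_disj)
    from this(1) this(2)[OF _ t0 max.cobounded1 max.cobounded2] show thesis by (rule that)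
  qed
  define \<rho> where "\<rho> t = ((1 + (L + 1) / \<gamma>) * \<omega>K \<bar>t - t0\<bar> + (\<alpha>h * norm (x t - x t0) + \<omega>h \<bar>t - t0\<bar>) / \<gamma>) / c" for t
  have bound: "norm (U \<eta> t (x t) - u0) \<le> \<rho> t" if t: "t \<in> {0..T}" for t
  proof -
    let ?F = "F_op P h \<eta> t (x t)"
    have "?F (P u0) - F0 (P u0) = - ((h t (x t) u0 \<eta> - h t (x t0) u0 \<eta>) + (h t (x t0) u0 \<eta> - h t0 (x t0) u0 \<eta>))"
      by (simp add: F_op_def F0_def)
    then have "norm (?F (P u0) - F0 (P u0))
        \<le> norm (h t (x t) u0 \<eta> - h t (x t0) u0 \<eta>) + norm (h t (x t0) u0 \<eta> - h t0 (x t0) u0 \<eta>)"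
      by (simp only: norm_minus_cancel norm_triangle_ineq)
    also have "\<dots> \<le> \<alpha>h * norm (x t - x t0) + \<omega>h \<bar>t - t0\<bar>"
      by (intro add_mono \<alpha>(2) \<omega>h(2) t)
    finally have 1: "norm (?F (P u0) - F0 (P u0)) \<le> \<alpha>h * norm (x t - x t0) + \<omega>h \<bar>t - t0\<bar>" .
    have "norm (P (U \<eta> t (x t)) - P u0)
        \<le> (1 + (L + 1) / \<gamma>) * norm (metric_proj (K t) z - P u0) + norm (?F (P u0) - F0 (P u0)) / \<gamma>"
      by (rule VI_stability_moving_set[OF K(1,2)[OF t] F(3,4)[OF t] U_solves[OF t]]) (simp add: z_def)
    also have "\<dots> \<le> (1 + (L + 1) / \<gamma>) * \<omega>K \<bar>t - t0\<bar> + (\<alpha>h * norm (x t - x t0) + \<omega>h \<bar>t - t0\<bar>) / \<gamma>"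
      using F(1,2) by (intro add_mono mult_left_mono divide_right_mono 1 \<omega>K(2) t) auto
    finally have "norm (P (U \<eta> t (x t)) - P u0) / c \<le> \<rho> t"
      unfolding \<rho>_def using c(1) by (intro divide_right_mono) auto
    then show ?thesis using c(2)[of "P (U \<eta> t (x t))" "P u0"] by simp
  qed
  have "(x \<longlongrightarrow> x t0) (at t0 within {0..T})" using x t0 by (auto simp: continuous_on_def)
  then have "(\<rho> \<longlongrightarrow> ((1 + (L + 1) / \<gamma>) * 0 + (\<alpha>h * norm (x t0 - x t0) + 0) / \<gamma>) / c) (at t0 within {0..T})"
    unfolding \<rho>_def using F(1) c(1)
    by (intro tendsto_intros modulus_tendsto_abs_diff \<omega>K(1) \<omega>h(1)) auto
  then have "(\<rho> \<longlongrightarrow> 0) (at t0 within {0..T})" by simp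
  moreover have "\<forall>\<^sub>F t in at t0 within {0..T}. norm (U \<eta> t (x t) - u0) \<le> \<rho> t"
    using bound by (auto simp: eventually_at_filter)
  ultimately have "((\<lambda>t. U \<eta> t (x t) - u0) \<longlongrightarrow> 0) (at t0 within {0..T})"
    by (rule Lim_null_comparison[rotated])
  then show "((\<lambda>t. U \<eta> t (x t)) \<longlongrightarrow> U \<eta> t0 (x t0)) (at t0 within {0..T})"
    unfolding u0_def by (simp only: LIM_zero_iff)
qed

section \<open>Existence, stability and uniqueness of mild solution pairs\<close>

lemma f_measurable:
  assumes "continuous_on {0..T} x" "continuous_on {0..T} u"
  shows "(\<lambda>s. f s (x s) (u s) \<eta>) \<in> borel_measurable (lebesgue_on {0..T})"
proof -
  obtain \<alpha>f \<beta>f where \<alpha>: "\<And>t x1 x2 u1 u2. t \<in> {0..T} \<Longrightarrow>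
      norm (f t x1 u1 \<eta> - f t x2 u2 \<eta>) \<le> \<alpha>f * norm (x1 - x2) + \<beta>f * norm (u1 - u2)"
    using Lipschitz_data[of "{\<eta>}"] by (metis bounded_insert bounded_empty singletonI)
  have "(\<lambda>s. (\<lambda>(x, u). f s x u \<eta>) (x s, u s)) \<in> borel_measurable (lebesgue_on {0..T})"
  proof (rule caratheodory_measurable[where G = "\<lambda>s (x, u). f s x u \<eta>"])
    show "(\<lambda>s. (\<lambda>(x, u). f s x u \<eta>) z) \<in> borel_measurable (lebesgue_on {0..T})" for z
      by (rule data[unfolded parameterized_data_def caratheodory_def, THEN conjunct1, THEN spec,
            THEN conjunct1, THEN conjunct1, THEN spec])
    show "(\<lambda>s. (x s, u s)) \<in> borel_measurable (lebesgue_on {0..T})"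
      using assms by (intro continuous_imp_measurable_on_sets_lebesgue continuous_on_Pair) auto
    fix s assume "s \<in> space (lebesgue_on {0..T})"
    then have s: "s \<in> {0..T}" by simp
    \<comment> \<open>Taken from the Lipschitz estimate, which holds at every time, while the
      Caratheodory condition leaves out a null set.\<close>
    show "continuous_on UNIV (\<lambda>(x, u). f s x u \<eta>)"
      unfolding continuous_on_def
    proof
      fix z :: "'h \<times> 'h"
      have "((\<lambda>w. \<alpha>f * norm (fst w - fst z) + \<beta>f * norm (snd w - snd z))
          \<longlongrightarrow> \<alpha>f * norm (fst z - fst z) + \<beta>f * norm (snd z - snd z)) (at z)"
        by (intro tendsto_intros)
      then have "((\<lambda>w. f s (fst w) (snd w) \<eta> - f s (fst z) (snd z) \<eta>) \<longlongrightarrow> 0) (at z)"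
        by (intro Lim_null_comparison[OF always_eventually[OF allI[OF \<alpha>[OF s]]]]) simp
      then show "((\<lambda>(x, u). f s x u \<eta>) \<longlongrightarrow> (\<lambda>(x, u). f s x u \<eta>) z) (at z)"
        by (simp only: LIM_zero_iff case_prod_unfold)
    qed
  qed
  then show ?thesis by simp
qed

lemma f_bounded:
  assumes "continuous_on {0..T} x" "continuous_on {0..T} u"
  obtains B where "\<And>s. s \<in> {0..T} \<Longrightarrow> norm (f s (x s) (u s) \<eta>) \<le> B"
proof -
  obtain \<alpha>f \<beta>f where \<alpha>: "\<alpha>f \<ge> 0" "\<beta>f \<ge> 0" "\<And>t x1 x2 u1 u2. t \<in> {0..T} \<Longrightarrow>
      norm (f t x1 u1 \<eta> - f t x2 u2 \<eta>) \<le> \<alpha>f * norm (x1 - x2) + \<beta>f * norm (u1 - u2)"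
    using Lipschitz_data[of "{\<eta>}"] by (metis bounded_insert bounded_empty singletonI)
  obtain C where C: "\<And>t. t \<in> {0..T} \<Longrightarrow> norm (f t 0 0 \<eta>) \<le> C" using f_origin_bounded by metis
  obtain X where X: "\<And>s. s \<in> {0..T} \<Longrightarrow> norm (x s) \<le> X" using continuous_on_Icc_bounded[OF assms(1)] by metis
  obtain V where V: "\<And>s. s \<in> {0..T} \<Longrightarrow> norm (u s) \<le> V" using continuous_on_Icc_bounded[OF assms(2)] by metis
  have "norm (f s (x s) (u s) \<eta>) \<le> C + (\<alpha>f * X + \<beta>f * V)" if s: "s \<in> {0..T}" for s
  proof -
    have "norm (f s (x s) (u s) \<eta>) \<le> norm (f s 0 0 \<eta>) + norm (f s (x s) (u s) \<eta> - f s 0 0 \<eta>)"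
      by (rule norm_triangle_sub)
    moreover have "norm (f s (x s) (u s) \<eta> - f s 0 0 \<eta>) \<le> \<alpha>f * norm (x s) + \<beta>f * norm (u s)"
      using \<alpha>(3)[OF s, of "x s" "u s" 0 0] by simp
    moreover have "\<alpha>f * norm (x s) + \<beta>f * norm (u s) \<le> \<alpha>f * X + \<beta>f * V"
      by (intro add_mono mult_left_mono X V s \<alpha>)
    ultimately show ?thesis using C[OF s] by linarith
  qed
  then show thesis using that by blast
qed

text \<open>For the last clause, \<open>u\<close> and \<open>U \<eta> t (x t)\<close> are both
  continuous and agree almost everywhere on the open interval, hence on all of
  \<open>{0..T}\<close>.\<close>

lemma mild_solution_pairD:
  assumes "mild_solution_pair T expA P K f h (\<zeta>, \<eta>) (x, u)"
  shows "continuous_on {0..T} x" "continuous_on {0..T} u" "x \<in> extensional {0..T}" "u \<in> extensional {0..T}"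
    and "\<And>t. t \<in> {0..T} \<Longrightarrow> x t = expA t \<zeta> + (LINT s:{0..t}|lebesgue. expA (t - s) (f s (x s) (u s) \<eta>))"
    and "\<And>t. t \<in> {0..T} \<Longrightarrow> u t = U \<eta> t (x t)"
proof -
  show x: "continuous_on {0..T} x" and u: "continuous_on {0..T} u"
    and "x \<in> extensional {0..T}" "u \<in> extensional {0..T}"
    using assms by (auto simp: mild_solution_pair_def mspace_C_metric)
  show "x t = expA t \<zeta> + (LINT s:{0..t}|lebesgue. expA (t - s) (f s (x s) (u s) \<eta>))" if "t \<in> {0..T}" for t
    using assms that by (auto simp: mild_solution_pair_def)
  have "AE t in lebesgue_on {0<..<T}. u t \<in> (\<lambda>\<xi>. h t (x t) (u t) \<eta> - \<xi>) ` normal_cone (K t) (P (u t))"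
    using assms by (auto simp: mild_solution_pair_def)
  then have "AE t in lebesgue_on {0<..<T}. u t - U \<eta> t (x t) = 0"
  proof (rule AE_mp, intro AE_I2 impI)
    fix t assume "t \<in> space (lebesgue_on {0<..<T})"
      and *: "u t \<in> (\<lambda>\<xi>. h t (x t) (u t) \<eta> - \<xi>) ` normal_cone (K t) (P (u t))"
    then have "t \<in> {0..T}" by simp
    from * show "u t - U \<eta> t (x t) = 0" unfolding inclusion_iff_U[OF \<open>t \<in> {0..T}\<close>] by simp
  qed
  from continuous_AE_zero_imp_zero[OF T _ this]
  show "u t = U \<eta> t (x t)" if "t \<in> {0..T}" for t
    using that continuous_on_diff[OF u U_continuous[OF x]] by auto
qed

lemma semigroup_bound:
  obtains M where "semigroup_bound expA T M"
proof -
  obtain M where "M \<ge> 1" "\<And>t x. t \<in> {0..T} \<Longrightarrow> norm (expA t x) \<le> M * norm x"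
    by (rule C0_semigroup_bounded[OF semigroup, of T]) blast
  then have "semigroup_bound expA T M"
    using semigroup T by (intro semigroup_bound.intro) auto
  then show thesis by (rule that)
qed

lemma mild_solution_exists: "\<exists>p. mild_solution_pair T expA P K f h (\<zeta>, \<eta>) p"
proof -
  obtain M where "semigroup_bound expA T M" by (rule semigroup_bound)
  then interpret S: semigroup_bound expA T M .
  have bd: "bounded {\<eta>}" by simp
  obtain \<alpha>f \<beta>f where \<alpha>: "\<alpha>f \<ge> 0" "\<beta>f \<ge> 0" "\<And>t x1 x2 u1 u2. t \<in> {0..T} \<Longrightarrow>
      norm (f t x1 u1 \<eta> - f t x2 u2 \<eta>) \<le> \<alpha>f * norm (x1 - x2) + \<beta>f * norm (u1 - u2)"
    using Lipschitz_data[OF bd] by (metis singletonI)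
  obtain c where c: "c \<ge> 0" "\<And>t x1 x2. t \<in> {0..T} \<Longrightarrow> norm (U \<eta> t x1 - U \<eta> t x2) \<le> c * norm (x1 - x2)"
  proof -
    obtain c where c: "c \<ge> 0" "\<And>t x1 x2 u1 u2. t \<in> {0..T} \<Longrightarrow>
      solves_VI (K t) (F_op P h \<eta> t x1) (P u1) \<Longrightarrow> solves_VI (K t) (F_op P h \<eta> t x2) (P u2) \<Longrightarrow>
      norm (u1 - u2) \<le> c * (norm (x1 - x2) + norm (h t x2 u2 \<eta> - h t x2 u2 \<eta>))"
      using U_stability[OF bd] by (metis singletonI)
    have "norm (U \<eta> t x1 - U \<eta> t x2) \<le> c * norm (x1 - x2)" if "t \<in> {0..T}" for t x1 x2
      using c(2)[OF that U_solves[OF that] U_solves[OF that]] by simp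
    with c(1) show thesis by (rule that)
  qed
  define G where "G s x = f s x (U \<eta> s x) \<eta>" for s x
  obtain x where x: "continuous_on {0..T} x"
    and eq: "\<And>t. t \<in> {0..T} \<Longrightarrow> x t = expA t \<zeta> + (LINT s:{0..t}|lebesgue. expA (t - s) (G s (x s)))"
  proof (rule S.mild_fixed_point)
    fix x :: "real \<Rightarrow> 'h" assume x: "continuous_on {0..T} x"
    show "(\<lambda>s. G s (x s)) \<in> borel_measurable (lebesgue_on {0..T})"
      unfolding G_def by (intro f_measurable x U_continuous)
    show "\<exists>B. \<forall>s\<in>{0..T}. norm (G s (x s)) \<le> B"
      unfolding G_def using f_bounded[OF x U_continuous[OF x]] by metis
  next
    fix s x y assume s: "s \<in> {0..T}"
    have "norm (G s x - G s y) \<le> \<alpha>f * norm (x - y) + \<beta>f * norm (U \<eta> s x - U \<eta> s y)"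
      unfolding G_def by (rule \<alpha>(3)[OF s])
    also have "\<dots> \<le> \<alpha>f * norm (x - y) + \<beta>f * (c * norm (x - y))"
      by (intro add_mono mult_left_mono c s \<alpha>) simp
    \<comment> \<open>The summand 1 only ensures that the Lipschitz constant is positive.\<close>
    also have "\<dots> \<le> (\<alpha>f + \<beta>f * c + 1) * norm (x - y)" by (simp add: algebra_simps)
    finally show "norm (G s x - G s y) \<le> (\<alpha>f + \<beta>f * c + 1) * norm (x - y)" .
  next
    show "\<alpha>f + \<beta>f * c + 1 > 0" using \<alpha> c by (simp add: add_nonneg_pos)
  qed blast
  \<comment> \<open>Restriction makes the functions extensional, as members of
    \<open>C_metric T\<close> must be.\<close>
  define X where "X = restrict x {0..T}"
  define V where "V = restrict (\<lambda>t. U \<eta> t (x t)) {0..T}"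
  have X: "continuous_on {0..T} X" and V: "continuous_on {0..T} V"
    by (rule continuous_on_eq[OF x], simp add: X_def) (rule continuous_on_eq[OF U_continuous[OF x]], simp add: V_def)
  obtain B where B: "\<And>s. s \<in> {0..T} \<Longrightarrow> norm (f s (X s) (V s) \<eta>) \<le> B" using f_bounded[OF X V] by metis
  have "mild_solution_pair T expA P K f h (\<zeta>, \<eta>) (X, V)"
    unfolding mild_solution_pair_def case_prod_conv
  proof (intro conjI ballI)
    show "X \<in> mspace (C_metric T)" "V \<in> mspace (C_metric T)"
      using X V by (auto simp: mspace_C_metric X_def V_def)
    fix t assume t: "t \<in> {0..T}"
    show "set_integrable lebesgue {0..t} (\<lambda>s. expA (t - s) (f s (X s) (V s) \<eta>))"
      by (rule S.convolution_integrable[OF f_measurable[OF X V] B t])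
    have "(LINT s:{0..t}|lebesgue. expA (t - s) (f s (X s) (V s) \<eta>))
        = (LINT s:{0..t}|lebesgue. expA (t - s) (G s (x s)))"
      using t by (intro set_lebesgue_integral_cong) (auto simp: X_def V_def G_def)
    then show "X t = expA t \<zeta> + (LINT s:{0..t}|lebesgue. expA (t - s) (f s (X s) (V s) \<eta>))"
      using eq[OF t] t by (simp add: X_def)
  next
    show "AE t in lebesgue_on {0<..<T}. V t \<in> (\<lambda>\<xi>. h t (X t) (V t) \<eta> - \<xi>) ` normal_cone (K t) (P (V t))"
    proof (rule AE_I2)
      fix t assume "t \<in> space (lebesgue_on {0<..<T})"
      then have t: "t \<in> {0..T}" by simp
      then show "V t \<in> (\<lambda>\<xi>. h t (X t) (V t) \<eta> - \<xi>) ` normal_cone (K t) (P (V t))"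
        unfolding inclusion_iff_U[OF t] by (simp add: X_def V_def)
    qed
  qed
  then show ?thesis by blast
qed

text \<open>Inserting the bound for \<open>u1 - u2\<close> into the Lipschitz estimate for
  \<open>f\<close> leaves a Gronwall inequality for \<open>norm (x1 - x2)\<close>; the controls then
  follow from the states. \<open>C\<close> depends on \<open>D\<close> but not on the
  solutions.\<close>

lemma mild_solution_stability:
  assumes D: "bounded D"
  obtains C where "C \<ge> 0"
    "\<And>\<zeta>1 \<zeta>2 \<eta>1 \<eta>2 x1 x2 u1 u2 \<epsilon> t. \<eta>1 \<in> D \<Longrightarrow> \<eta>2 \<in> D \<Longrightarrow>
      mild_solution_pair T expA P K f h (\<zeta>1, \<eta>1) (x1, u1) \<Longrightarrow>
      mild_solution_pair T expA P K f h (\<zeta>2, \<eta>2) (x2, u2) \<Longrightarrow>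
      (\<And>s. s \<in> {0..T} \<Longrightarrow> norm (f s (x2 s) (u2 s) \<eta>1 - f s (x2 s) (u2 s) \<eta>2) \<le> \<epsilon>) \<Longrightarrow>
      (\<And>s. s \<in> {0..T} \<Longrightarrow> norm (h s (x2 s) (u2 s) \<eta>1 - h s (x2 s) (u2 s) \<eta>2) \<le> \<epsilon>) \<Longrightarrow>
      t \<in> {0..T} \<Longrightarrow>
      norm (x1 t - x2 t) \<le> C * (norm (\<zeta>1 - \<zeta>2) + \<epsilon>) \<and> norm (u1 t - u2 t) \<le> C * (norm (\<zeta>1 - \<zeta>2) + \<epsilon>)"
proof -
  obtain M where "semigroup_bound expA T M" by (rule semigroup_bound)
  then interpret S: semigroup_bound expA T M .
  obtain \<alpha>f \<beta>f where \<alpha>: "\<alpha>f \<ge> 0" "\<beta>f \<ge> 0" "\<And>t \<eta> x1 x2 u1 u2. t \<in> {0..T} \<Longrightarrow> \<eta> \<in> D \<Longrightarrow>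
      norm (f t x1 u1 \<eta> - f t x2 u2 \<eta>) \<le> \<alpha>f * norm (x1 - x2) + \<beta>f * norm (u1 - u2)"
    using Lipschitz_data[OF D] by metis
  obtain c where c: "c \<ge> 0" "\<And>t \<eta>1 \<eta>2 x1 x2 u1 u2. t \<in> {0..T} \<Longrightarrow> \<eta>1 \<in> D \<Longrightarrow> \<eta>2 \<in> D \<Longrightarrow>
      solves_VI (K t) (F_op P h \<eta>1 t x1) (P u1) \<Longrightarrow> solves_VI (K t) (F_op P h \<eta>2 t x2) (P u2) \<Longrightarrow>
      norm (u1 - u2) \<le> c * (norm (x1 - x2) + norm (h t x2 u2 \<eta>1 - h t x2 u2 \<eta>2))"
    using U_stability[OF D] by metis
  \<comment> \<open>\<open>L\<close> collects the multiples of the state difference and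
    \<open>b\<close> those of \<open>\<epsilon>\<close>. The 1 in \<open>L\<close> ensures
    positivity, the 1 in \<open>b\<close> is the direct perturbation of \<open>f\<close>.
    \<open>C1\<close> is the Gronwall constant for the states, and \<open>C\<close> also covers the
    controls.\<close>
  define L where "L = M * (\<alpha>f + \<beta>f * c + 1)"
  define b where "b = M * (\<beta>f * c + 1)"
  define C1 where "C1 = 2 * (M + b * T) * exp (2 * L * T)"
  define C where "C = C1 + c * (C1 + 1)"
  have L: "L > 0" and b: "b \<ge> 0" using S.M(1) \<alpha> c by (auto simp: L_def b_def add_nonneg_pos)
  have C1: "C1 \<ge> 0" using S.M(1) b T by (simp add: C1_def)
  have C: "C \<ge> 0" "C1 \<le> C" "c * (C1 + 1) \<le> C" using C1 c(1) by (auto simp: C_def)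
  show thesis
  proof (rule that[OF C(1)])
    fix \<zeta>1 \<zeta>2 \<eta>1 \<eta>2 x1 x2 u1 u2 \<epsilon> t
    assume \<eta>: "\<eta>1 \<in> D" "\<eta>2 \<in> D"
      and sol1: "mild_solution_pair T expA P K f h (\<zeta>1, \<eta>1) (x1, u1)"
      and sol2: "mild_solution_pair T expA P K f h (\<zeta>2, \<eta>2) (x2, u2)"
      and \<epsilon>f: "\<And>s. s \<in> {0..T} \<Longrightarrow> norm (f s (x2 s) (u2 s) \<eta>1 - f s (x2 s) (u2 s) \<eta>2) \<le> \<epsilon>"
      and \<epsilon>h: "\<And>s. s \<in> {0..T} \<Longrightarrow> norm (h s (x2 s) (u2 s) \<eta>1 - h s (x2 s) (u2 s) \<eta>2) \<le> \<epsilon>"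
      and t: "t \<in> {0..T}"
    note s1 = mild_solution_pairD[OF sol1] and s2 = mild_solution_pairD[OF sol2]
    have \<epsilon>: "\<epsilon> \<ge> 0" using \<epsilon>f[OF t] norm_ge_zero order_trans by blast
    define \<phi> where "\<phi> s = norm (x1 s - x2 s)" for s
    have u: "norm (u1 s - u2 s) \<le> c * (\<phi> s + \<epsilon>)" if s: "s \<in> {0..T}" for s
    proof -
      have "norm (u1 s - u2 s) \<le> c * (\<phi> s + norm (h s (x2 s) (u2 s) \<eta>1 - h s (x2 s) (u2 s) \<eta>2))"
        unfolding \<phi>_def using U_solves[OF s] s1(6)[OF s] s2(6)[OF s] by (intro c(2) s \<eta>) auto
      also have "\<dots> \<le> c * (\<phi> s + \<epsilon>)" by (intro mult_left_mono add_left_mono \<epsilon>h s c(1))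
      finally show ?thesis .
    qed
    have fdiff: "M * norm (f s (x1 s) (u1 s) \<eta>1 - f s (x2 s) (u2 s) \<eta>2) \<le> b * \<epsilon> + L * \<phi> s"
      if s: "s \<in> {0..T}" for s
    proof -
      have "norm (f s (x1 s) (u1 s) \<eta>1 - f s (x2 s) (u2 s) \<eta>2)
          \<le> norm (f s (x1 s) (u1 s) \<eta>1 - f s (x2 s) (u2 s) \<eta>1)
            + norm (f s (x2 s) (u2 s) \<eta>1 - f s (x2 s) (u2 s) \<eta>2)"
        by (metis norm_triangle_ineq diff_add_cancel add_diff_eq)
      also have "\<dots> \<le> (\<alpha>f * \<phi> s + \<beta>f * norm (u1 s - u2 s)) + \<epsilon>"
        unfolding \<phi>_def by (intro add_mono \<alpha>(3) \<epsilon>f s \<eta>)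
      also have "\<dots> \<le> (\<alpha>f * \<phi> s + \<beta>f * (c * (\<phi> s + \<epsilon>))) + \<epsilon>"
        by (intro add_mono mult_left_mono u s \<alpha>) auto
      also have "\<dots> \<le> (\<beta>f * c + 1) * \<epsilon> + (\<alpha>f + \<beta>f * c + 1) * \<phi> s"
        by (simp add: algebra_simps \<phi>_def)
      finally have "M * norm (f s (x1 s) (u1 s) \<eta>1 - f s (x2 s) (u2 s) \<eta>2)
          \<le> M * ((\<beta>f * c + 1) * \<epsilon> + (\<alpha>f + \<beta>f * c + 1) * \<phi> s)"
        using S.M(1) by (intro mult_left_mono) auto
      then show ?thesis by (simp add: L_def b_def algebra_simps)
    qed
    have \<phi>: "continuous_on {0..T} \<phi>"
      unfolding \<phi>_def by (intro continuous_intros s1 s2)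
    obtain B1 where B1: "\<And>s. s \<in> {0..T} \<Longrightarrow> norm (f s (x1 s) (u1 s) \<eta>1) \<le> B1"
      using f_bounded[OF s1(1,2)] by metis
    obtain B2 where B2: "\<And>s. s \<in> {0..T} \<Longrightarrow> norm (f s (x2 s) (u2 s) \<eta>2) \<le> B2"
      using f_bounded[OF s2(1,2)] by metis
    have "\<phi> r \<le> M * norm (\<zeta>1 - \<zeta>2) + (LINT s:{0..r}|lebesgue. b * \<epsilon> + L * \<phi> s)" if r: "r \<in> {0..T}" for r
    proof -
      define I1 I2 where "I1 = (LINT s:{0..r}|lebesgue. expA (r - s) (f s (x1 s) (u1 s) \<eta>1))"
        and "I2 = (LINT s:{0..r}|lebesgue. expA (r - s) (f s (x2 s) (u2 s) \<eta>2))"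
      have "norm (I1 - I2) \<le> (LINT s:{0..r}|lebesgue. b * \<epsilon> + L * \<phi> s)"
        unfolding I1_def I2_def
      proof (rule S.convolution_diff_le[OF f_measurable[OF s1(1,2)] B1 f_measurable[OF s2(1,2)] B2 r])
        have "continuous_on {0..r} (\<lambda>s. b * \<epsilon> + L * \<phi> s)"
          using r by (intro continuous_intros continuous_on_subset[OF \<phi>]) auto
        then show "set_integrable lebesgue {0..r} (\<lambda>s. b * \<epsilon> + L * \<phi> s)"
          by (metis absolutely_integrable_continuous_real)
        show "M * norm (f s (x1 s) (u1 s) \<eta>1 - f s (x2 s) (u2 s) \<eta>2) \<le> b * \<epsilon> + L * \<phi> s"
          if "s \<in> {0..r}" for s using that r by (intro fdiff) auto
      qed
      moreover have "x1 r - x2 r = expA r (\<zeta>1 - \<zeta>2) + (I1 - I2)"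
        using s1(5)[OF r] s2(5)[OF r] linear_diff[OF bounded_linear.linear[OF S.bounded_linear_S[of r]]] r
        by (simp add: I1_def I2_def)
      then have "\<phi> r \<le> norm (expA r (\<zeta>1 - \<zeta>2)) + norm (I1 - I2)"
        unfolding \<phi>_def by (simp only: norm_triangle_ineq)
      moreover have "norm (expA r (\<zeta>1 - \<zeta>2)) \<le> M * norm (\<zeta>1 - \<zeta>2)" by (rule S.M(2)[OF r])
      ultimately show ?thesis by linarith
    qed
    then have "\<phi> t \<le> 2 * (M * norm (\<zeta>1 - \<zeta>2) + b * \<epsilon> * T) * exp (2 * L * T)"
      using t T L \<epsilon> b S.M(1) by (intro Gronwall_weighted[OF _ \<phi> L]) (auto simp: \<phi>_def)
    also have "\<dots> \<le> 2 * ((M + b * T) * (norm (\<zeta>1 - \<zeta>2) + \<epsilon>)) * exp (2 * L * T)"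
      using T b \<epsilon> S.M(1) by (intro mult_right_mono mult_left_mono) (auto simp: algebra_simps)
    also have "\<dots> = C1 * (norm (\<zeta>1 - \<zeta>2) + \<epsilon>)" by (simp add: C1_def)
    finally have x: "\<phi> t \<le> C1 * (norm (\<zeta>1 - \<zeta>2) + \<epsilon>)" .
    also have "\<dots> \<le> C * (norm (\<zeta>1 - \<zeta>2) + \<epsilon>)" using C \<epsilon> by (intro mult_right_mono) auto
    finally have "norm (x1 t - x2 t) \<le> C * (norm (\<zeta>1 - \<zeta>2) + \<epsilon>)" by (simp add: \<phi>_def)
    moreover have "norm (u1 t - u2 t) \<le> C * (norm (\<zeta>1 - \<zeta>2) + \<epsilon>)"
    proof -
      have "norm (u1 t - u2 t) \<le> c * (\<phi> t + \<epsilon>)" by (rule u[OF t])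
      also have "\<phi> t + \<epsilon> \<le> (C1 + 1) * (norm (\<zeta>1 - \<zeta>2) + \<epsilon>)"
        using x norm_ge_zero[of "\<zeta>1 - \<zeta>2"] by (simp only: distrib_right mult_1_left)
      then have "c * (\<phi> t + \<epsilon>) \<le> c * ((C1 + 1) * (norm (\<zeta>1 - \<zeta>2) + \<epsilon>))"
        using c(1) by (intro mult_left_mono)
      also have "\<dots> \<le> C * (norm (\<zeta>1 - \<zeta>2) + \<epsilon>)"
        unfolding mult.assoc[symmetric] using C \<epsilon> by (intro mult_right_mono) auto
      finally show ?thesis .
    qed
    ultimately show "norm (x1 t - x2 t) \<le> C * (norm (\<zeta>1 - \<zeta>2) + \<epsilon>) \<and> norm (u1 t - u2 t) \<le> C * (norm (\<zeta>1 - \<zeta>2) + \<epsilon>)"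
      by blast
  qed
qed

text \<open>For equal data the stability estimate applies with \<open>\<epsilon> = 0\<close>;
  extensionality turns agreement on \<open>{0..T}\<close> into equality.\<close>

lemma mild_solution_unique: "\<exists>!p. mild_solution_pair T expA P K f h d p"
proof -
  obtain \<zeta> \<eta> where d: "d = (\<zeta>, \<eta>)" by (cases d)
  have "p = q" if p: "mild_solution_pair T expA P K f h d p" and q: "mild_solution_pair T expA P K f h d q" for p q
  proof -
    obtain x1 u1 x2 u2 where pq: "p = (x1, u1)" "q = (x2, u2)" by (cases p, cases q)
    note sol = p[unfolded pq d] q[unfolded pq d]
    have "bounded {\<eta>}" by simp
    then obtain C where C: "\<And>\<zeta>1 \<zeta>2 x1 x2 u1 u2 \<epsilon> t.
      mild_solution_pair T expA P K f h (\<zeta>1, \<eta>) (x1, u1) \<Longrightarrow>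
      mild_solution_pair T expA P K f h (\<zeta>2, \<eta>) (x2, u2) \<Longrightarrow>
      (\<And>s. s \<in> {0..T} \<Longrightarrow> norm (f s (x2 s) (u2 s) \<eta> - f s (x2 s) (u2 s) \<eta>) \<le> \<epsilon>) \<Longrightarrow>
      (\<And>s. s \<in> {0..T} \<Longrightarrow> norm (h s (x2 s) (u2 s) \<eta> - h s (x2 s) (u2 s) \<eta>) \<le> \<epsilon>) \<Longrightarrow>
      t \<in> {0..T} \<Longrightarrow>
      norm (x1 t - x2 t) \<le> C * (norm (\<zeta>1 - \<zeta>2) + \<epsilon>) \<and> norm (u1 t - u2 t) \<le> C * (norm (\<zeta>1 - \<zeta>2) + \<epsilon>)"
      by (rule mild_solution_stability) blast
    have "x1 t = x2 t \<and> u1 t = u2 t" if "t \<in> {0..T}" for t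
      using C[OF sol, of 0 t] that by simp
    then show ?thesis
      unfolding pq using mild_solution_pairD(3,4)[OF sol(1)] mild_solution_pairD(3,4)[OF sol(2)]
      by (auto intro: extensionalityI)
  qed
  then show ?thesis using mild_solution_exists[of \<zeta> \<eta>] d by blast
qed

lemma solution_map_solves: "mild_solution_pair T expA P K f h d (solution_map T expA P K f h d)"
  unfolding solution_map_def by (rule theI'[OF mild_solution_unique])

lemma modulus_small:
  assumes "modulus g" "e > 0"
  obtains \<delta> where "\<delta> > 0" "\<And>r. 0 < r \<Longrightarrow> r < \<delta> \<Longrightarrow> g r < e"
  using order_tendstoD(2)[of g 0 "at_right 0" e] assms
  by (auto simp: modulus_def eventually_at_right_field)

text \<open>The reference solution takes the second place in the stability estimate, so
  \<open>D\<close>, \<open>R\<close>, the moduli and \<open>C\<close> are all chosen from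
  \<open>d\<close> before \<open>d'\<close> appears.\<close>

lemma solution_map_eps_delta:
  assumes e: "e > 0"
  obtains \<delta> where "\<delta> > 0" "\<And>d'. mdist data_metric d d' < \<delta> \<Longrightarrow>
    mdist (prod_metric (C_metric T) (C_metric T)) (solution_map T expA P K f h d) (solution_map T expA P K f h d') < e"
proof -
  obtain \<zeta> \<eta> where d: "d = (\<zeta>, \<eta>)" by (cases d)
  obtain x u where xu: "solution_map T expA P K f h d = (x, u)" by (cases "solution_map T expA P K f h d")
  have sol: "mild_solution_pair T expA P K f h (\<zeta>, \<eta>) (x, u)"
    using solution_map_solves[of d] by (simp add: d xu[unfolded d])
  note s = mild_solution_pairD[OF sol]
  define D where "D = cball \<eta> 1"
  have D: "bounded D" "\<eta> \<in> D" by (auto simp: D_def)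
  obtain C where C: "C \<ge> 0" and stab: "\<And>\<zeta>1 \<zeta>2 \<eta>1 \<eta>2 x1 x2 u1 u2 \<epsilon> t. \<eta>1 \<in> D \<Longrightarrow> \<eta>2 \<in> D \<Longrightarrow>
      mild_solution_pair T expA P K f h (\<zeta>1, \<eta>1) (x1, u1) \<Longrightarrow>
      mild_solution_pair T expA P K f h (\<zeta>2, \<eta>2) (x2, u2) \<Longrightarrow>
      (\<And>s. s \<in> {0..T} \<Longrightarrow> norm (f s (x2 s) (u2 s) \<eta>1 - f s (x2 s) (u2 s) \<eta>2) \<le> \<epsilon>) \<Longrightarrow>
      (\<And>s. s \<in> {0..T} \<Longrightarrow> norm (h s (x2 s) (u2 s) \<eta>1 - h s (x2 s) (u2 s) \<eta>2) \<le> \<epsilon>) \<Longrightarrow>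
      t \<in> {0..T} \<Longrightarrow>
      norm (x1 t - x2 t) \<le> C * (norm (\<zeta>1 - \<zeta>2) + \<epsilon>) \<and> norm (u1 t - u2 t) \<le> C * (norm (\<zeta>1 - \<zeta>2) + \<epsilon>)"
    using mild_solution_stability[OF D(1)] by blast
  obtain X where X: "\<And>s. s \<in> {0..T} \<Longrightarrow> norm (x s) \<le> X" using continuous_on_Icc_bounded[OF s(1)] by metis
  obtain V where V: "\<And>s. s \<in> {0..T} \<Longrightarrow> norm (u s) \<le> V" using continuous_on_Icc_bounded[OF s(2)] by metis
  define R where "R = max 0 (max X V)"
  have R: "R \<ge> 0" "\<And>s. s \<in> {0..T} \<Longrightarrow> norm (x s) \<le> R" "\<And>s. s \<in> {0..T} \<Longrightarrow> norm (u s) \<le> R"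
    using X V by (auto simp: R_def le_max_iff_disj)
  obtain \<gamma>f \<gamma>h where \<gamma>: "modulus \<gamma>f" "modulus \<gamma>h"
    "\<And>t \<eta>1 \<eta>2 x u. t \<in> {0..T} \<Longrightarrow> \<eta>1 \<in> D \<Longrightarrow> \<eta>2 \<in> D \<Longrightarrow> norm x \<le> R \<Longrightarrow> norm u \<le> R \<Longrightarrow>
      norm (f t x u \<eta>1 - f t x u \<eta>2) \<le> \<gamma>f (dist \<eta>1 \<eta>2) \<and>
      norm (h t x u \<eta>1 - h t x u \<eta>2) \<le> \<gamma>h (dist \<eta>1 \<eta>2)"
    using parameter_moduli[OF D(1) R(1)] by metis
  \<comment> \<open>With \<open>norm (\<zeta>' - \<zeta>) < \<epsilon>\<close> the estimate gives at
    most \<open>2 * C * \<epsilon> \<le> e / 4\<close> in each component; \<open>C + 1\<close>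
    avoids division by zero.\<close>
  define \<epsilon> where "\<epsilon> = e / (8 * (C + 1))"
  have \<epsilon>: "\<epsilon> > 0" using e C by (simp add: \<epsilon>_def)
  obtain \<delta>f where \<delta>f: "\<delta>f > 0" "\<And>r. 0 < r \<Longrightarrow> r < \<delta>f \<Longrightarrow> \<gamma>f r < \<epsilon>" using modulus_small[OF \<gamma>(1) \<epsilon>] by metis
  obtain \<delta>h where \<delta>h: "\<delta>h > 0" "\<And>r. 0 < r \<Longrightarrow> r < \<delta>h \<Longrightarrow> \<gamma>h r < \<epsilon>" using modulus_small[OF \<gamma>(2) \<epsilon>] by metis
  \<comment> \<open>1 keeps \<open>\<eta>'\<close> in \<open>D\<close>, \<open>\<epsilon>\<close>
    bounds the initial values, and \<open>\<delta>f\<close>, \<open>\<delta>h\<close> bound the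
    parameter errors.\<close>
  define \<delta> where "\<delta> = min (min 1 \<epsilon>) (min \<delta>f \<delta>h)"
  show thesis
  proof (rule that)
    show "\<delta> > 0" using \<epsilon> \<delta>f \<delta>h by (simp add: \<delta>_def)
    fix d' assume dd: "mdist data_metric d d' < \<delta>"
    obtain \<zeta>' \<eta>' where d': "d' = (\<zeta>', \<eta>')" by (cases d')
    obtain x' u' where xu': "solution_map T expA P K f h d' = (x', u')" by (cases "solution_map T expA P K f h d'")
    have sol': "mild_solution_pair T expA P K f h (\<zeta>', \<eta>') (x', u')"
      using solution_map_solves[of d'] by (simp add: d' xu'[unfolded d'])
    have "norm (\<zeta> - \<zeta>') + dist \<eta> \<eta>' < \<delta>" using dd by (simp add: d d')
    then have \<zeta>\<delta>: "norm (\<zeta>' - \<zeta>) < \<delta>" and \<eta>\<delta>: "dist \<eta>' \<eta> < \<delta>"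
      using zero_le_dist[of \<eta> \<eta>'] norm_ge_zero[of "\<zeta> - \<zeta>'"]
      unfolding norm_minus_commute[of \<zeta>' \<zeta>] dist_commute[of \<eta>' \<eta>] by linarith+
    have "\<eta>' \<in> D" using \<eta>\<delta> by (simp add: D_def \<delta>_def dist_commute)
    have fh: "norm (f s (x s) (u s) \<eta>' - f s (x s) (u s) \<eta>) \<le> \<epsilon> \<and> norm (h s (x s) (u s) \<eta>' - h s (x s) (u s) \<eta>) \<le> \<epsilon>"
      if s: "s \<in> {0..T}" for s
    proof (cases "\<eta>' = \<eta>") \<comment> \<open>a modulus may be nonzero at \<open>0\<close>\<close>
      case True
      then show ?thesis using \<epsilon> by simp
    next
      case False
      then have "\<gamma>f (dist \<eta>' \<eta>) < \<epsilon>" "\<gamma>h (dist \<eta>' \<eta>) < \<epsilon>"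
        using \<eta>\<delta> by (auto intro!: \<delta>f(2) \<delta>h(2) simp: \<delta>_def)
      with \<gamma>(3)[OF s \<open>\<eta>' \<in> D\<close> D(2) R(2,3)[OF s]] show ?thesis by linarith
    qed
    have "C * (norm (\<zeta>' - \<zeta>) + \<epsilon>) \<le> e / 4"
    proof -
      have "C * (norm (\<zeta>' - \<zeta>) + \<epsilon>) \<le> (C + 1) * (\<epsilon> + \<epsilon>)"
        using \<zeta>\<delta> C \<epsilon> by (intro mult_mono) (auto simp: \<delta>_def)
      also have "\<dots> = e / 4"
      proof -
        have "k * (e / (8 * k) + e / (8 * k)) = e / 4" if "k > 0" for k :: real
          using that by (simp add: field_simps)
        moreover have "C + 1 > 0" using C by simp
        ultimately show ?thesis unfolding \<epsilon>_def by blast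
      qed
      finally show ?thesis .
    qed
    then have close: "norm (x t - x' t) \<le> e / 4 \<and> norm (u t - u' t) \<le> e / 4" if "t \<in> {0..T}" for t
      using stab[OF \<open>\<eta>' \<in> D\<close> D(2) sol' sol, of \<epsilon> t] fh that by (force simp: norm_minus_commute)
    have ms: "x \<in> mspace (C_metric T)" "u \<in> mspace (C_metric T)" "x' \<in> mspace (C_metric T)" "u' \<in> mspace (C_metric T)"
      using sol sol' by (auto simp: mild_solution_pair_def)
    have "mdist (C_metric T) x x' \<le> e / 4"
      unfolding mdist_C_metric[OF ms(1,3) less_imp_le[OF T]]
      using close T by (intro cSUP_least) auto
    moreover have "mdist (C_metric T) u u' \<le> e / 4"
      unfolding mdist_C_metric[OF ms(2,4) less_imp_le[OF T]]
      using close T by (intro cSUP_least) auto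
    \<comment> \<open>The product metric is Euclidean and at most the sum of the components, here
      \<open>e / 2\<close>; the slack is needed because suprema preserve only weak
      inequalities.\<close>
    moreover have "prod_dist (mdist (C_metric T)) (mdist (C_metric T)) (x, u) (x', u')
        \<le> mdist (C_metric T) x x' + mdist (C_metric T) u u'"
      by (simp add: prod_dist_def sqrt_sum_squares_le_sum)
    ultimately show "mdist (prod_metric (C_metric T) (C_metric T)) (solution_map T expA P K f h d)
        (solution_map T expA P K f h d') < e"
      using e by (simp add: xu xu')
  qed
qed

lemma solution_map_continuous:
  "continuous_map (mtopology_of data_metric) (mtopology_of (prod_metric (C_metric T) (C_metric T)))
    (solution_map T expA P K f h)"
proof -
  have "solution_map T expA P K f h d \<in> mspace (prod_metric (C_metric T) (C_metric T))" for d
    using solution_map_solves[of d] by (cases d, cases "solution_map T expA P K f h d")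
      (auto simp: mild_solution_pair_def)
  moreover have "\<exists>\<delta>>0. \<forall>d'. mdist data_metric d d' < \<delta> \<longrightarrow>
      mdist (prod_metric (C_metric T) (C_metric T)) (solution_map T expA P K f h d)
        (solution_map T expA P K f h d') < e" if "e > 0" for d e
    using that by (rule solution_map_eps_delta) blast
  ultimately show ?thesis
    unfolding mtopology_of_def
      Metric_space.metric_continuous_map[OF Metric_space_mspace_mdist Metric_space_mspace_mdist]
    by (simp only: mspace_data_metric) blast
qed

end

text \<open>Unique existence ensures that the definite description \<open>solution_map\<close>
  denotes the solution pair. Sequential convergence is obtained from topological continuity.\<close>

theorem theorem6p9:
  fixes T :: real
    and A :: "('h::{real_inner, banach, second_countable_topology} \<times> 'h) set"
    and expA :: "real \<Rightarrow> 'h \<Rightarrow> 'h"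
    and P :: "'h \<Rightarrow> 'h"
    and K :: "real \<Rightarrow> 'h set"
    and f h :: "real \<Rightarrow> 'h \<Rightarrow> 'h \<Rightarrow> 'e::metric_space \<Rightarrow> 'h"
  assumes "T > 0"
    and "standing_assumption T A expA P K f h"
    and "set_regularity T K"
    and "parameterized_data T P K f h"
  shows "(\<forall>\<zeta> \<eta>. \<exists>!p. mild_solution_pair T expA P K f h (\<zeta>, \<eta>) p) \<and>
     (\<forall>\<zeta>s \<eta>s \<zeta> \<eta>.
        limitin (mtopology_of data_metric) (\<lambda>n::nat. (\<zeta>s n, \<eta>s n)) (\<zeta>, \<eta>) sequentially \<longrightarrow>
        limitin (mtopology_of (prod_metric (C_metric T) (C_metric T)))
          (\<lambda>n. solution_map T expA P K f h (\<zeta>s n, \<eta>s n))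
          (solution_map T expA P K f h (\<zeta>, \<eta>)) sequentially) \<and>
     continuous_map (mtopology_of data_metric)
       (mtopology_of (prod_metric (C_metric T) (C_metric T)))
       (solution_map T expA P K f h)"
proof -
  interpret evolution_VI T A expA P K f h
    using assms by (intro evolution_VI.intro)
  show ?thesis
    using mild_solution_unique solution_map_continuous continuous_map_limit[OF solution_map_continuous]
    by (auto simp: o_def)
qed

end
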